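(* There are (exactly) fifteen possible order types of two circles in $\mathbb{R}^3$ lying in distinct planes.
   Context: Circles and planes are identified with their Zariski closures in $\mathbb{CP}^3$. Let $C_1,C_2$ be circles in $\mathbb{R}^3$ lying in distinct planes $\Pi_1,\Pi_2$ and let $\ell=\Pi_1\cap\Pi_2$. Let $m_1$ be the number of real points of $C_1\cap\Pi_2$ and $m_2$ the number of real points of $C_2\cap\Pi_1$ (a point of tangency counted once), so $m_i\in\{0,1,2\}$; order the circles so that $m_1\geq m_2$. The order type of the pair records the order, along the line $\ell$, of the real points of $C_1\cap\ell$ and $C_2\cap\ell$: a point of $C_i$ only is written $i$ (once, if $C_i$ is tangent to $\ell$ there), and a point shared by both circles is written $S$. Sequences are considered up to reversal and, when $m_1=m_2$, up to interchanging the labels 1 and 2; the intersection type $[m_1,m_2]$ is part of the data. For example, $(1,2,1,2)$ means that $m_1=m_2=2$ and the four points are distinct and alternate; $(1,S)$ means that $C_1$ meets $\ell$ in two real points and $C_2$ is tangent to $\ell$ at one of them. When $m_1=m_2=0$ there are two cases: the order type is $\emptyset$ if $C_1\cap C_2=\emptyset$ in $\mathbb{CP}^3$, and $(2c)$ if $C_1\cap\ell=C_2\cap\ell$ (a pair of complex conjugate points). *)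

theory Defs
  imports "HOL-Analysis.Analysis"
begin

section \<open>Complex projective 3-space and Zariski closure\<close>

definition proj_eq :: "complex^4 \<Rightarrow> complex^4 \<Rightarrow> bool" where
  "proj_eq z w \<longleftrightarrow> z \<noteq> 0 \<and> w \<noteq> 0 \<and> (\<exists>c. w = c *s z)"

lemma proj_eq_part_equivp: "part_equivp proj_eq"
proof (rule part_equivpI)
  have "proj_eq (axis 1 1) (axis 1 1)"
    unfolding proj_eq_def by (auto simp: axis_eq_0_iff intro: exI[of _ 1])
  then show "\<exists>z. proj_eq z z" by blast
  show "symp proj_eq"
  proof (rule sympI)
    fix z w assume "proj_eq z w"
    then obtain c where c: "z \<noteq> 0" "w \<noteq> 0" "w = c *s z"
      unfolding proj_eq_def by blast
    then have "z = inverse c *s w"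
      by (auto simp: vector_smult_assoc)
    with c(1,2) show "proj_eq w z" unfolding proj_eq_def by blast
  qed
  show "transp proj_eq"
    unfolding proj_eq_def by (rule transpI) (auto simp: vector_smult_assoc)
qed

quotient_type cp3 = "complex^4" / partial: proj_eq
  by (rule proj_eq_part_equivp)

definition real_points :: "cp3 set" where
  "real_points = {abs_cp3 (\<chi> i. complex_of_real (x $ i)) | x. x \<noteq> 0}"

text \<open>The inclusion \<open>(x, y, z) \<mapsto> [x : y : z : 1]\<close>; the plane at infinity is
  where the fourth coordinate vanishes.\<close>

definition of_affine :: "real^3 \<Rightarrow> cp3" where
  "of_affine x = abs_cp3 (vector [complex_of_real (x $ 1), complex_of_real (x $ 2),
     complex_of_real (x $ 3), 1])"

text \<open>Homogeneous polynomials of degree \<open>d\<close>, given by the coefficients \<open>a e\<close> of the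
  finitely many monomials with exponent vector \<open>e\<close>, and regarded as functions.\<close>

definition hom_poly :: "nat \<Rightarrow> (complex^4 \<Rightarrow> complex) \<Rightarrow> bool" where
  "hom_poly d f \<longleftrightarrow> (\<exists>a :: (4 \<Rightarrow> nat) \<Rightarrow> complex.
     f = (\<lambda>z. \<Sum>e | (\<Sum>i\<in>UNIV. e i) = d. a e * (\<Prod>i\<in>UNIV. z $ i ^ e i)))"

definition vanishes_at :: "(complex^4 \<Rightarrow> complex) \<Rightarrow> cp3 \<Rightarrow> bool" where
  "vanishes_at f p \<longleftrightarrow> (\<forall>z. z \<noteq> 0 \<and> abs_cp3 z = p \<longrightarrow> f z = 0)"

definition zariski_closure :: "cp3 set \<Rightarrow> cp3 set" where
  "zariski_closure A =
     {p. \<forall>d f. hom_poly d f \<and> (\<forall>q\<in>A. vanishes_at f q) \<longrightarrow> vanishes_at f p}"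

abbreviation pcl :: "(real^3) set \<Rightarrow> cp3 set" where
  "pcl A \<equiv> zariski_closure (of_affine ` A)"


section \<open>Pairs of circles and their order types\<close>

definition is_plane :: "(real^3) set \<Rightarrow> bool" where
  "is_plane P \<longleftrightarrow> affine P \<and> aff_dim P = 2"

definition circle_in :: "(real^3) set \<Rightarrow> (real^3) set \<Rightarrow> bool" where
  "circle_in P C \<longleftrightarrow> (\<exists>c\<in>P. \<exists>r>0. C = P \<inter> sphere c r)"

text \<open>Two circles in distinct planes. Parallel planes are allowed: their projective closures
  then meet in a line at infinity.\<close>

definition circle_pair ::
  "(real^3) set \<Rightarrow> (real^3) set \<Rightarrow> (real^3) set \<Rightarrow> (real^3) set \<Rightarrow> bool" where
  "circle_pair P1 C1 P2 C2 \<longleftrightarrow> is_plane P1 \<and> is_plane P2 \<and> P1 \<noteq> P2 \<and>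
     circle_in P1 C1 \<and> circle_in P2 C2"

text \<open>With \<open>C\<close> the one circle and \<open>P\<close> the plane of the other, this is the number \<open>m\<close> of real
  points of \<open>C \<inter> P\<close>.\<close>

definition num_real :: "(real^3) set \<Rightarrow> (real^3) set \<Rightarrow> nat" where
  "num_real C P = card (pcl C \<inter> pcl P \<inter> real_points)"

datatype label = L1 | L2 | S

fun swap_label :: "label \<Rightarrow> label" where
  "swap_label L1 = L2"
| "swap_label L2 = L1"
| "swap_label S = S"

definition label_of :: "(real^3) set \<Rightarrow> (real^3) set \<Rightarrow> cp3 \<Rightarrow> label" where
  "label_of C1 C2 p =
     (if p \<in> pcl C1 \<inter> pcl C2 then S else if p \<in> pcl C1 then L1 else L2)"

text \<open>The list \<open>ps\<close> runs through the real points of the two circles on the line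
  \<open>pcl P1 \<inter> pcl P2\<close>, in the order given by a direction vector \<open>v\<close> of that line. This is only
  used when some circle has a real point on the line, so that the line is not at infinity.\<close>

definition label_sequence ::
  "(real^3) set \<Rightarrow> (real^3) set \<Rightarrow> (real^3) set \<Rightarrow> (real^3) set \<Rightarrow> label list \<Rightarrow> bool" where
  "label_sequence P1 C1 P2 C2 xs \<longleftrightarrow> (\<exists>v ps.
     v \<noteq> 0 \<and> (\<forall>x\<in>P1. x + v \<in> P1) \<and> (\<forall>x\<in>P2. x + v \<in> P2) \<and>
     sorted_wrt (\<lambda>x y. x \<bullet> v < y \<bullet> v) ps \<and>
     of_affine ` set ps = (pcl C1 \<union> pcl C2) \<inter> (pcl P1 \<inter> pcl P2) \<inter> real_points \<and>
     xs = map (\<lambda>x. label_of C1 C2 (of_affine x)) ps)"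

definition sequence_class :: "nat \<Rightarrow> nat \<Rightarrow> label list \<Rightarrow> label list set" where
  "sequence_class m1 m2 xs = {xs, rev xs} \<union>
     (if m1 = m2 then {map swap_label xs, rev (map swap_label xs)} else {})"

text \<open>\<open>Sequence m1 m2 X\<close> has intersection type \<open>[m1, m2]\<close> and class \<open>X\<close> of label sequences;
  \<open>Disjoint\<close> and \<open>Conjugate\<close> are the types \<open>\<emptyset>\<close> and \<open>(2c)\<close>, both with \<open>m1 = m2 = 0\<close>.\<close>

datatype order_type = Disjoint | Conjugate | Sequence nat nat "label list set"

text \<open>The order type of a pair that is already ordered so that \<open>m1 \<ge> m2\<close>.\<close>

inductive ordered_pair_type ::
  "(real^3) set \<Rightarrow> (real^3) set \<Rightarrow> (real^3) set \<Rightarrow> (real^3) set \<Rightarrow> order_type \<Rightarrow> bool"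
  for P1 C1 P2 C2 where
  disjoint: "ordered_pair_type P1 C1 P2 C2 Disjoint"
    if "num_real C1 P2 = 0" "num_real C2 P1 = 0" "pcl C1 \<inter> pcl C2 = {}"
| conjugate: "ordered_pair_type P1 C1 P2 C2 Conjugate"
    if "num_real C1 P2 = 0" "num_real C2 P1 = 0"
      "pcl C1 \<inter> (pcl P1 \<inter> pcl P2) = pcl C2 \<inter> (pcl P1 \<inter> pcl P2)"
| sequence: "ordered_pair_type P1 C1 P2 C2 (Sequence m1 m2 (sequence_class m1 m2 xs))"
    if "m1 = num_real C1 P2" "m2 = num_real C2 P1" "m1 \<ge> m2" "m1 > 0"
      "label_sequence P1 C1 P2 C2 xs"

definition has_order_type ::
  "(real^3) set \<Rightarrow> (real^3) set \<Rightarrow> (real^3) set \<Rightarrow> (real^3) set \<Rightarrow> order_type \<Rightarrow> bool" where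
  "has_order_type P1 C1 P2 C2 T \<longleftrightarrow>
     ordered_pair_type P1 C1 P2 C2 T \<or> ordered_pair_type P2 C2 P1 C1 T"

end

theory Submission
  imports Defs "HOL-Computational_Algebra.Fundamental_Theorem_Algebra"
begin

text \<open>A circle is the intersection of a plane with a sphere, so its closure satisfies a linear and a
  quadratic equation. These equations have no real solutions beyond the points of the circle, since
  at infinity the equation of a sphere is definite (\<open>real_points_pcl_circle\<close>). Hence the numbers
  \<open>m1\<close>, \<open>m2\<close> and the label sequences depend only on real geometry: each circle meets the line
  \<open>\<ell>\<close> of the two planes in at most two points, listing the points along \<open>\<ell>\<close> is possible in exactly two
  ways, which are reverses of each other, and the equivalence built into \<open>sequence_class\<close> absorbs this
  choice and the choice of the first circle when \<open>m1 = m2\<close>.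

  Complex points matter only if neither circle has a real point on \<open>\<ell>\<close>. Then the closure of each circle
  meets \<open>\<ell>\<close> in two conjugate points: at least one exists, because a rational parametrization of the
  circle turns the equation of the other plane into a polynomial of degree 2
  (\<open>pcl_circle_meets_pcl_plane\<close>), its conjugate lies on the closure too, and a real quadratic form
  without real zeros has no others on the line through the two
  (\<open>conic_line_conjugate_points\<close>). Two conjugate pairs
  are disjoint or equal, so exactly one of \<open>Disjoint\<close> and \<open>Conjugate\<close> holds. The argument works with
  homogeneous coordinates and so covers parallel planes.

  It remains to count. The types with a label sequence are those of the sequences in which between
  1 and 2 labels belong to the first circle and no more to the second: every such sequence is
  realised, because in two perpendicular planes one can prescribe independently the at most two
  points in which each circle meets \<open>\<ell>\<close> (\<open>label_sequence_realised\<close>). These sequences fall into 13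
  classes, and \<open>Disjoint\<close> and \<open>Conjugate\<close> are realised as well.\<close>

section \<open>Homogeneous polynomials and points of complex projective space\<close>

lemma abs_cp3_eq_iff:
  assumes "z \<noteq> 0" "w \<noteq> 0"
  shows "abs_cp3 z = abs_cp3 w \<longleftrightarrow> (\<exists>c. w = c *s z)"
proof -
  have refl: "proj_eq x x" if "x \<noteq> 0" for x
    using that unfolding proj_eq_def by (auto intro: exI[of _ 1])
  show ?thesis
    using Quotient3_rel[OF Quotient3_cp3, of z w] assms refl
    by (auto simp: proj_eq_def)
qed

lemma cp3_cases:
  obtains z where "z \<noteq> 0" "p = abs_cp3 z"
  using Quotient3_rep_reflp[OF Quotient3_cp3, of p] Quotient3_abs_rep[OF Quotient3_cp3, of p]
  unfolding proj_eq_def by metis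

text \<open>The polynomials of the definition are sums over this set of exponents; were it infinite, those
  sums would be 0 and only the zero polynomial would be homogeneous.\<close>

lemma finite_exponents: "finite {e :: 4 \<Rightarrow> nat. (\<Sum>i\<in>UNIV. e i) = d}"
proof (rule finite_subset)
  show "{e :: 4 \<Rightarrow> nat. (\<Sum>i\<in>UNIV. e i) = d} \<subseteq> UNIV \<rightarrow>\<^sub>E {..d}"
    by (auto intro: member_le_sum)
  show "finite ((UNIV :: 4 set) \<rightarrow>\<^sub>E {..d})"
    by (intro finite_PiE) auto
qed

lemma hom_poly_add:
  assumes "hom_poly d f" "hom_poly d g"
  shows "hom_poly d (\<lambda>z. f z + g z)"
proof -
  obtain a b where "f = (\<lambda>z. \<Sum>e | (\<Sum>i\<in>UNIV. e i) = d. a e * (\<Prod>i\<in>UNIV. z $ i ^ e i))"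
    "g = (\<lambda>z. \<Sum>e | (\<Sum>i\<in>UNIV. e i) = d. b e * (\<Prod>i\<in>UNIV. z $ i ^ e i))"
    using assms unfolding hom_poly_def by auto
  then show ?thesis
    unfolding hom_poly_def
    by (intro exI[of _ "\<lambda>e. a e + b e"]) (simp add: sum.distrib distrib_right)
qed

lemma hom_poly_scale:
  assumes "hom_poly d f"
  shows "hom_poly d (\<lambda>z. c * f z)"
proof -
  obtain a where "f = (\<lambda>z. \<Sum>e | (\<Sum>i\<in>UNIV. e i) = d. a e * (\<Prod>i\<in>UNIV. z $ i ^ e i))"
    using assms unfolding hom_poly_def by auto
  then show ?thesis
    unfolding hom_poly_def
    by (intro exI[of _ "\<lambda>e. c * a e"]) (simp add: sum_distrib_left mult.assoc)
qed

lemma hom_poly_monomial: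
  assumes "(\<Sum>i\<in>UNIV. e i) = d"
  shows "hom_poly d (\<lambda>z. \<Prod>i\<in>UNIV. z $ i ^ e i)"
  unfolding hom_poly_def
proof (intro exI ext)
  fix z :: "complex^4"
  have "(\<Sum>e' | (\<Sum>i\<in>UNIV. e' i) = d. of_bool (e' = e) * (\<Prod>i\<in>UNIV. z $ i ^ e' i))
      = (\<Sum>e' | (\<Sum>i\<in>UNIV. e' i) = d. if e' = e then \<Prod>i\<in>UNIV. z $ i ^ e i else 0)"
    by (intro sum.cong) auto
  also have "\<dots> = (\<Prod>i\<in>UNIV. z $ i ^ e i)"
    using assms by (simp add: finite_exponents)
  finally show "(\<Prod>i\<in>UNIV. z $ i ^ e i)
      = (\<Sum>e' | (\<Sum>i\<in>UNIV. e' i) = d. of_bool (e' = e) * (\<Prod>i\<in>UNIV. z $ i ^ e' i))" ..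
qed

lemma hom_poly_coordinate: "hom_poly 1 (\<lambda>z. z $ k)"
  using hom_poly_monomial[of "\<lambda>i. if i = k then 1 else 0" 1]
  by (simp add: if_distrib[of "power _"] cong: if_cong)

lemma hom_poly_coordinate_mult: "hom_poly 2 (\<lambda>z. z $ k * z $ l)"
  using hom_poly_monomial[of "\<lambda>i. (if i = k then 1 else 0) + (if i = l then 1 else 0)" 2]
  by (simp add: sum.distrib power_add prod.distrib if_distrib[of "power _"] cong: if_cong)

lemma hom_poly_homogeneous:
  assumes "hom_poly d f"
  shows "f (c *s z) = c ^ d * f z"
proof -
  obtain a where a: "f = (\<lambda>z. \<Sum>e | (\<Sum>i\<in>UNIV. e i) = d. a e * (\<Prod>i\<in>UNIV. z $ i ^ e i))"
    using assms unfolding hom_poly_def by auto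
  show ?thesis
    unfolding a sum_distrib_left
    by (intro sum.cong) (auto simp: power_mult_distrib prod.distrib mult_ac simp flip: power_sum)
qed

definition cnj_vec :: "complex^4 \<Rightarrow> complex^4" where
  "cnj_vec z = (\<chi> i. cnj (z $ i))"

text \<open>Conjugating the coefficients of a form gives the form \<open>z \<mapsto> cnj (f (cnj z))\<close>. So forms that vanish
  on a set of real points come in conjugate pairs, and the closure of such a set is closed under
  conjugation.\<close>

lemma hom_poly_conjugate:
  assumes "hom_poly d f"
  shows "hom_poly d (\<lambda>z. cnj (f (cnj_vec z)))"
proof -
  obtain a where a: "f = (\<lambda>z. \<Sum>e | (\<Sum>i\<in>UNIV. e i) = d. a e * (\<Prod>i\<in>UNIV. z $ i ^ e i))"
    using assms unfolding hom_poly_def by auto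
  show ?thesis
    unfolding a hom_poly_def
    by (intro exI[of _ "\<lambda>e. cnj (a e)"]) (simp add: cnj_vec_def)
qed

text \<open>Restricted to a curve with polynomial coordinates, a form becomes a polynomial in one parameter,
  for which infinitely many zeros force identical vanishing.\<close>

lemma hom_poly_on_quadratic_curve:
  assumes "hom_poly d f"
  obtains p where "\<And>s. f (X + s *s Y + s\<^sup>2 *s W) = poly p s"
proof -
  obtain a where a: "f = (\<lambda>z. \<Sum>e | (\<Sum>i\<in>UNIV. e i) = d. a e * (\<Prod>i\<in>UNIV. z $ i ^ e i))"
    using assms unfolding hom_poly_def by auto
  have "f (X + s *s Y + s\<^sup>2 *s W) = poly (\<Sum>e | (\<Sum>i\<in>UNIV. e i) = d.
      Polynomial.smult (a e) (\<Prod>i\<in>UNIV. [:X $ i, Y $ i, W $ i:] ^ e i)) s" for s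
    unfolding a by (simp add: poly_sum poly_prod power2_eq_square algebra_simps)
  then show thesis by (rule that)
qed

section \<open>Equations of planes and spheres\<close>

definition real_vec :: "real^4 \<Rightarrow> complex^4" where
  "real_vec x = (\<chi> i. complex_of_real (x $ i))"

definition lift :: "real^3 \<Rightarrow> complex^4" where
  "lift x = vector [complex_of_real (x $ 1), complex_of_real (x $ 2), complex_of_real (x $ 3), 1]"

definition plane_form :: "real^3 \<Rightarrow> real \<Rightarrow> complex^4 \<Rightarrow> complex" where
  "plane_form a b z = of_real (a $ 1) * z $ 1 + of_real (a $ 2) * z $ 2 + of_real (a $ 3) * z $ 3
     - of_real b * z $ 4"

definition sphere_form :: "real^3 \<Rightarrow> real \<Rightarrow> complex^4 \<Rightarrow> complex" where
  "sphere_form c r z = (z $ 1)\<^sup>2 + (z $ 2)\<^sup>2 + (z $ 3)\<^sup>2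
     - 2 * (of_real (c $ 1) * z $ 1 + of_real (c $ 2) * z $ 2 + of_real (c $ 3) * z $ 3) * z $ 4
     + of_real (c \<bullet> c - r\<^sup>2) * (z $ 4)\<^sup>2"

lemma lift_nth [simp]:
  "lift x $ 1 = of_real (x $ 1)" "lift x $ 2 = of_real (x $ 2)" "lift x $ 3 = of_real (x $ 3)"
  "lift x $ 4 = 1"
  by (simp_all add: lift_def vector_def)

lemma lift_nonzero [simp]: "lift x \<noteq> 0"
  by (metis lift_nth(4) zero_index zero_neq_one)

lemma of_affine_lift: "of_affine x = abs_cp3 (lift x)"
  by (simp add: of_affine_def lift_def)

lemma lift_eq_scaled_iff: "lift x = c *s lift y \<longleftrightarrow> c = 1 \<and> x = y"
  by (auto simp: vec_eq_iff forall_4 forall_3)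

lemma inj_of_affine: "inj of_affine"
  by (rule injI) (simp add: of_affine_lift abs_cp3_eq_iff lift_eq_scaled_iff)

lemma of_affine_real: "of_affine x \<in> real_points"
proof -
  define y :: "real^4" where "y = vector [x $ 1, x $ 2, x $ 3, 1]"
  have y: "y $ 1 = x $ 1" "y $ 2 = x $ 2" "y $ 3 = x $ 3" "y $ 4 = 1"
    by (simp_all add: y_def vector_def)
  have "lift x = real_vec y"
    by (simp add: vec_eq_iff forall_4 real_vec_def y)
  moreover have "y \<noteq> 0"
    using y(4) by auto
  ultimately show ?thesis
    unfolding real_points_def of_affine_lift real_vec_def by auto
qed

lemma hom_poly_plane_form: "hom_poly 1 (plane_form a b)"
proof -
  have "plane_form a b = (\<lambda>z. of_real (a $ 1) * z $ 1 + of_real (a $ 2) * z $ 2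
      + of_real (a $ 3) * z $ 3 + of_real (- b) * z $ 4)"
    by (simp add: plane_form_def fun_eq_iff)
  then show ?thesis
    by (simp only:) (intro hom_poly_add hom_poly_scale hom_poly_coordinate)
qed

lemma hom_poly_sphere_form: "hom_poly 2 (sphere_form c r)"
proof -
  have "sphere_form c r = (\<lambda>z. z $ 1 * z $ 1 + z $ 2 * z $ 2 + z $ 3 * z $ 3
      + of_real (- 2 * c $ 1) * (z $ 1 * z $ 4) + of_real (- 2 * c $ 2) * (z $ 2 * z $ 4)
      + of_real (- 2 * c $ 3) * (z $ 3 * z $ 4) + of_real (c \<bullet> c - r\<^sup>2) * (z $ 4 * z $ 4))"
    by (simp add: sphere_form_def fun_eq_iff power2_eq_square algebra_simps)
  then show ?thesis
    by (simp only:) (intro hom_poly_add hom_poly_scale hom_poly_coordinate_mult)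
qed

lemma plane_form_lift: "plane_form a b (lift x) = of_real (a \<bullet> x - b)"
  by (simp add: plane_form_def inner_vec_def sum_3)

lemma sphere_form_lift: "sphere_form c r (lift x) = of_real ((dist c x)\<^sup>2 - r\<^sup>2)"
proof -
  have d: "(dist c x)\<^sup>2 = (c $ 1 - x $ 1)\<^sup>2 + (c $ 2 - x $ 2)\<^sup>2 + (c $ 3 - x $ 3)\<^sup>2"
    unfolding dist_norm power2_norm_eq_inner by (simp add: inner_vec_def sum_3 power2_eq_square)
  show ?thesis
    unfolding d sphere_form_def inner_vec_def sum_3 lift_nth
    by (simp add: power2_eq_square) (simp add: algebra_simps)
qed

lemma sphere_form_lift_eq_0_iff:
  "r > 0 \<Longrightarrow> sphere_form c r (lift x) = 0 \<longleftrightarrow> x \<in> sphere c r"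
  unfolding sphere_form_lift of_real_eq_0_iff by simp

lemma plane_form_add: "plane_form a b (z + w) = plane_form a b z + plane_form a b w"
  and plane_form_scale: "plane_form a b (c *s z) = c * plane_form a b z"
  by (simp_all add: plane_form_def algebra_simps)

lemma plane_form_cnj: "plane_form a b (cnj_vec z) = cnj (plane_form a b z)"
  by (simp add: plane_form_def cnj_vec_def)

lemma sphere_form_cnj: "sphere_form a b (cnj_vec z) = cnj (sphere_form a b z)"
  by (simp add: sphere_form_def cnj_vec_def)

section \<open>Points of Zariski closures\<close>

lemma vanishes_at_abs_cp3:
  assumes "hom_poly d f" "z \<noteq> 0"
  shows "vanishes_at f (abs_cp3 z) \<longleftrightarrow> f z = 0"
proof
  assume f: "f z = 0"
  have "f w = 0" if w: "w \<noteq> 0" "abs_cp3 w = abs_cp3 z" for w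
  proof -
    obtain k where "w = k *s z"
      using w assms(2) abs_cp3_eq_iff[of z w] by auto
    then show ?thesis
      by (simp add: hom_poly_homogeneous[OF assms(1)] f)
  qed
  then show "vanishes_at f (abs_cp3 z)"
    unfolding vanishes_at_def by blast
qed (use assms(2) in \<open>auto simp: vanishes_at_def\<close>)

text \<open>A form vanishes at all representatives of a point or at none, so membership in a closure can be
  tested on one representative.\<close>

lemma abs_cp3_in_pcl_iff:
  assumes "z \<noteq> 0"
  shows "abs_cp3 z \<in> pcl A \<longleftrightarrow>
    (\<forall>d f. hom_poly d f \<and> (\<forall>x\<in>A. f (lift x) = 0) \<longrightarrow> f z = 0)"
proof -
  have "(\<forall>q\<in>of_affine ` A. vanishes_at f q) \<longleftrightarrow> (\<forall>x\<in>A. f (lift x) = 0)" if "hom_poly d f" for d f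
    using that by (simp add: of_affine_lift vanishes_at_abs_cp3)
  then show ?thesis
    using assms unfolding zariski_closure_def mem_Collect_eq by (metis vanishes_at_abs_cp3)
qed

lemma of_affine_in_pcl: "x \<in> A \<Longrightarrow> of_affine x \<in> pcl A"
  unfolding of_affine_lift[of x] by (simp add: abs_cp3_in_pcl_iff)

lemma pcl_mono: "A \<subseteq> B \<Longrightarrow> pcl A \<subseteq> pcl B"
  unfolding zariski_closure_def by blast

lemma cnj_vec_nonzero [simp]: "cnj_vec z = 0 \<longleftrightarrow> z = 0"
  by (simp add: cnj_vec_def vec_eq_iff)

lemma cnj_vec_lift [simp]: "cnj_vec (lift x) = lift x"
  by (simp add: cnj_vec_def vec_eq_iff forall_4)

lemma pcl_cnj:
  assumes "z \<noteq> 0" "abs_cp3 z \<in> pcl A"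
  shows "abs_cp3 (cnj_vec z) \<in> pcl A"
proof -
  have "f (cnj_vec z) = 0" if f: "hom_poly d f" "\<forall>x\<in>A. f (lift x) = 0" for d f
    using hom_poly_conjugate[OF f(1)] f(2) assms by (force simp: abs_cp3_in_pcl_iff)
  then show ?thesis
    using assms(1) by (auto simp: abs_cp3_in_pcl_iff)
qed

text \<open>The source of all complex points of the closures: once infinitely many parameters give points of
  the set, every form vanishing on the set vanishes on the whole curve, complex parameters included.\<close>

lemma quadratic_curve_in_pcl:
  assumes "infinite I"
    and on_cone: "\<And>s. s \<in> I \<Longrightarrow> \<exists>x\<in>A. \<exists>c. X + s *s Y + s\<^sup>2 *s W = c *s lift x"
    and "X + t *s Y + t\<^sup>2 *s W \<noteq> 0"
  shows "abs_cp3 (X + t *s Y + t\<^sup>2 *s W) \<in> pcl A"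
proof -
  have "f (X + t *s Y + t\<^sup>2 *s W) = 0" if f: "hom_poly d f" "\<forall>x\<in>A. f (lift x) = 0" for d f
  proof -
    obtain p where p: "\<And>s. f (X + s *s Y + s\<^sup>2 *s W) = poly p s"
      using hom_poly_on_quadratic_curve[OF f(1)] by metis
    have "poly p s = 0" if "s \<in> I" for s
    proof -
      obtain x k where "x \<in> A" "X + s *s Y + s\<^sup>2 *s W = k *s lift x"
        using on_cone[OF \<open>s \<in> I\<close>] by blast
      then show ?thesis
        using f(2) by (simp flip: p add: hom_poly_homogeneous[OF f(1)])
    qed
    then have "I \<subseteq> {s. poly p s = 0}" by blast
    then have "p = 0"
      using poly_roots_finite[of p] \<open>infinite I\<close> finite_subset by blast
    then show ?thesis by (simp add: p)
  qed
  then show ?thesis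
    using assms(3) by (auto simp: abs_cp3_in_pcl_iff)
qed

section \<open>Real points of the closures of circles and planes\<close>

lemma is_plane_iff: "is_plane P \<longleftrightarrow> (\<exists>a b. a \<noteq> 0 \<and> P = {x. a \<bullet> x = b})"
proof
  assume P: "is_plane P"
  have hull: "affine hull P = P"
    using P unfolding is_plane_def affine_hull_eq by blast
  have "aff_dim P = DIM(real^3) - 1"
    using P by (simp add: is_plane_def)
  then show "\<exists>a b. a \<noteq> 0 \<and> P = {x. a \<bullet> x = b}"
    unfolding aff_dim_eq_hyperplane hull .
next
  assume "\<exists>a b. a \<noteq> 0 \<and> P = {x. a \<bullet> x = b}"
  then show "is_plane P"
    by (auto simp: is_plane_def affine_hyperplane)
qed

lemma is_planeE:
  assumes "is_plane P"
  obtains a b where "a \<noteq> 0" "P = {x. a \<bullet> x = b}"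
  using assms is_plane_iff by blast

lemma circle_inE:
  assumes "circle_in P C"
  obtains c r where "r > 0" "c \<in> P" "C = P \<inter> sphere c r"
  using assms unfolding circle_in_def by blast

text \<open>Forms bound the closures from above: a linear or quadratic equation of the set persists.\<close>

lemma plane_form_pcl:
  assumes "z \<noteq> 0" "abs_cp3 z \<in> pcl A" "A \<subseteq> {x. a \<bullet> x = b}"
  shows "plane_form a b z = 0"
proof -
  have "\<forall>x\<in>A. plane_form a b (lift x) = 0"
    using assms(3) by (auto simp: plane_form_lift)
  then show ?thesis
    using assms(2) hom_poly_plane_form[of a b] unfolding abs_cp3_in_pcl_iff[OF assms(1)] by blast
qed

lemma sphere_form_pcl:
  assumes "z \<noteq> 0" "abs_cp3 z \<in> pcl A" "A \<subseteq> sphere c r"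
  shows "sphere_form c r z = 0"
proof -
  have "\<forall>x\<in>A. sphere_form c r (lift x) = 0"
    using assms(3) by (auto simp: sphere_form_lift)
  then show ?thesis
    using assms(2) hom_poly_sphere_form[of c r] unfolding abs_cp3_in_pcl_iff[OF assms(1)] by blast
qed

lemma of_affine_in_pcl_plane_iff:
  "of_affine x \<in> pcl {x. a \<bullet> x = b} \<longleftrightarrow> x \<in> {x. a \<bullet> x = b}"
  using plane_form_pcl[of "lift x" "{x. a \<bullet> x = b}" a b] of_affine_in_pcl
  by (auto simp: plane_form_lift of_affine_lift)

lemma real_vec_nonzero [simp]: "real_vec x = 0 \<longleftrightarrow> x = 0"
  by (simp add: real_vec_def vec_eq_iff)

lemma real_vec_finite_point:
  assumes "x $ 4 \<noteq> 0"
  obtains y where "real_vec x = of_real (x $ 4) *s lift y"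
proof
  show "real_vec x = of_real (x $ 4) *s lift (vector [x $ 1 / x $ 4, x $ 2 / x $ 4, x $ 3 / x $ 4])"
    using assms by (simp add: vec_eq_iff forall_4 real_vec_def)
qed

text \<open>At infinity, the equation of a sphere reduces to \<open>x\<^sub>1\<^sup>2 + x\<^sub>2\<^sup>2 + x\<^sub>3\<^sup>2 = 0\<close>, which has no real
  solution other than 0.\<close>

lemma real_zero_of_sphere_form:
  assumes "x \<noteq> 0" "sphere_form c r (real_vec x) = 0"
  shows "x $ 4 \<noteq> 0"
proof
  assume x4: "x $ 4 = 0"
  have "complex_of_real ((x $ 1)\<^sup>2 + (x $ 2)\<^sup>2 + (x $ 3)\<^sup>2) = 0"
    using assms(2) x4 by (simp add: sphere_form_def real_vec_def)
  then have "(x $ 1)\<^sup>2 + (x $ 2)\<^sup>2 + (x $ 3)\<^sup>2 = 0"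
    by (simp only: of_real_eq_0_iff)
  then have "x $ 1 = 0" "x $ 2 = 0" "x $ 3 = 0"
    by (smt (verit) zero_le_power2 power2_eq_iff_nonneg zero_power2 power_eq_0_iff)+
  with x4 assms(1) show False
    by (simp add: vec_eq_iff forall_4)
qed

text \<open>A real point of the closure satisfies the equations of the plane and of the sphere. By the second
  it is a finite point, and then both equations say that it lies on the circle.\<close>

lemma real_points_pcl_circle:
  assumes "is_plane P" "circle_in P C"
  shows "pcl C \<inter> real_points = of_affine ` C"
proof
  obtain a b where P: "P = {x. a \<bullet> x = b}"
    using assms(1) by (rule is_planeE)
  obtain c r where C: "r > 0" "C = P \<inter> sphere c r"
    using assms(2) by (rule circle_inE)
  show "pcl C \<inter> real_points \<subseteq> of_affine ` C"
  proof
    fix p assume p: "p \<in> pcl C \<inter> real_points"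
    then obtain x where x: "x \<noteq> 0" "p = abs_cp3 (real_vec x)"
      unfolding real_points_def real_vec_def by blast
    have form: "plane_form a b (real_vec x) = 0" "sphere_form c r (real_vec x) = 0"
      using p x by (auto intro!: plane_form_pcl[where A = C] sphere_form_pcl[where A = C] simp: C P)
    then have x4: "x $ 4 \<noteq> 0"
      using real_zero_of_sphere_form x(1) by blast
    then obtain y where y: "real_vec x = of_real (x $ 4) *s lift y"
      by (rule real_vec_finite_point)
    have "plane_form a b (lift y) = 0" "sphere_form c r (lift y) = 0"
      using form x4 unfolding y
      by (simp_all add: plane_form_scale hom_poly_homogeneous[OF hom_poly_sphere_form])
    then have "y \<in> C"
      using sphere_form_lift_eq_0_iff[OF C(1)]
      by (simp add: C(2) P plane_form_lift del: of_real_diff)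
    moreover have "p = of_affine y"
      unfolding x(2) of_affine_lift using y x x4 by (metis abs_cp3_eq_iff lift_nonzero real_vec_nonzero)
    ultimately show "p \<in> of_affine ` C" by blast
  qed
  show "of_affine ` C \<subseteq> pcl C \<inter> real_points"
    using of_affine_in_pcl of_affine_real by blast
qed

lemma of_affine_in_pcl_circle_iff:
  assumes "is_plane P" "circle_in P C"
  shows "of_affine x \<in> pcl C \<longleftrightarrow> x \<in> C"
  using real_points_pcl_circle[OF assms] of_affine_real inj_of_affine
  by (metis IntE IntI image_iff inj_image_mem_iff)

lemma real_points_pcl_circle_plane:
  assumes "is_plane P" "circle_in P C" "is_plane P'"
  shows "pcl C \<inter> pcl P' \<inter> real_points = of_affine ` (C \<inter> P')"
proof -
  obtain a b where P': "P' = {x. a \<bullet> x = b}"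
    using assms(3) by (rule is_planeE)
  have "pcl C \<inter> pcl P' \<inter> real_points = of_affine ` C \<inter> pcl P'"
    using real_points_pcl_circle[OF assms(1,2)] by blast
  also have "\<dots> = of_affine ` (C \<inter> P')"
    using of_affine_in_pcl_plane_iff[of _ a b] unfolding P' by blast
  finally show ?thesis .
qed

lemma num_real_eq_card:
  assumes "is_plane P" "circle_in P C" "is_plane P'"
  shows "num_real C P' = card (C \<inter> P')"
  unfolding num_real_def real_points_pcl_circle_plane[OF assms]
  by (simp add: card_image inj_on_subset[OF inj_of_affine])

section \<open>Complex points of the closures of circles and planes\<close>

text \<open>Let \<open>z = x + \<i> y\<close> with real \<open>x\<close> and \<open>y\<close>, and let \<open>q\<close> represent a finite point of the plane. The curve
  \<open>(x + q) + s y + s\<^sup>2 q\<close> passes through \<open>z\<close> at \<open>s = \<i>\<close>. For real \<open>s\<close> it stays in the real plane,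
  and the terms in \<open>q\<close> make its fourth coordinate a monic quadratic in \<open>s\<close>, so that it is at infinity
  for at most two parameters even if \<open>z\<close> itself is at infinity.\<close>

lemma complex_plane_in_pcl:
  assumes "a \<noteq> 0" "z \<noteq> 0" "plane_form a b z = 0"
  shows "abs_cp3 z \<in> pcl {x. a \<bullet> x = b}"
proof -
  define q where "q = (b / (a \<bullet> a)) *\<^sub>R a"
  have q: "a \<bullet> q = b"
    using assms(1) by (simp add: q_def)
  define X where "X = (\<chi> i. complex_of_real (Re (z $ i))) + lift q"
  define Y where "Y = (\<chi> i. complex_of_real (Im (z $ i)))"
  define I where "I = {s. poly [:Re (z $ 4) + 1, Im (z $ 4), 1:] s \<noteq> 0}"
  have z: "X + \<i> *s Y + \<i>\<^sup>2 *s lift q = z"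
    by (simp add: X_def Y_def vec_eq_iff complex_eq_iff)
  have re: "plane_form a b (\<chi> i. complex_of_real (Re (z $ i))) = 0"
    and im: "plane_form a b Y = 0"
    using assms(3) by (simp_all add: Y_def plane_form_def complex_eq_iff)
  have "infinite (- {s. poly [:Re (z $ 4) + 1, Im (z $ 4), 1:] s = 0})"
    by (intro Diff_infinite_finite[of _ UNIV, folded Compl_eq_Diff_UNIV] poly_roots_finite
        infinite_UNIV_char_0) simp
  then have "infinite I"
    by (simp add: I_def Collect_neg_eq)
  then have "infinite (complex_of_real ` I)"
    by (simp add: finite_image_iff inj_on_def)
  moreover have "\<exists>x\<in>{x. a \<bullet> x = b}. \<exists>k. X + s *s Y + s\<^sup>2 *s lift q = k *s lift x"
    if "s \<in> complex_of_real ` I" for s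
  proof -
    obtain t where t: "t \<in> I" "s = of_real t"
      using \<open>s \<in> complex_of_real ` I\<close> by blast
    define x where "x = (\<chi> i. Re (z $ i) + t * Im (z $ i) + (1 + t\<^sup>2) * Re (lift q $ i))"
    have "lift q $ i = of_real (Re (lift q $ i))" for i
      using exhaust_4[of i] by auto
    then have x: "X + s *s Y + s\<^sup>2 *s lift q = real_vec x"
      by (simp add: X_def Y_def x_def t(2) real_vec_def vec_eq_iff complex_eq_iff algebra_simps)
    have "x $ 4 \<noteq> 0"
      using t(1) by (simp add: x_def I_def power2_eq_square algebra_simps)
    moreover from this obtain y where y: "real_vec x = of_real (x $ 4) *s lift y"
      by (rule real_vec_finite_point)
    moreover have "plane_form a b (real_vec x) = 0"
      by (simp flip: x add: X_def plane_form_add plane_form_scale re im plane_form_lift q)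
    ultimately have "a \<bullet> y = b"
      by (simp add: plane_form_scale plane_form_lift)
    then show ?thesis
      using x y by auto
  qed
  moreover have "X + \<i> *s Y + \<i>\<^sup>2 *s lift q \<noteq> 0"
    unfolding z by (rule assms(2))
  ultimately show ?thesis
    using quadratic_curve_in_pcl[of "complex_of_real ` I" "{x. a \<bullet> x = b}" X Y "lift q" \<i>]
    unfolding z by blast
qed

text \<open>The curve is the rational parametrization of the circle by
  \<open>c + r ((1 - t\<^sup>2) u + 2 t w) / (1 + t\<^sup>2)\<close>, with the denominator moved to the fourth coordinate.
  It is defined for complex parameters too, and \<open>t = \<i>\<close> gives a circular point at infinity.\<close>

lemma circle_curve_in_pcl:
  fixes t :: complex
  assumes "r > 0" and on: "a \<bullet> c = b" "a \<bullet> u = 0" "a \<bullet> w = 0"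
    and orthonormal: "norm u = 1" "norm w = 1" "u \<bullet> w = 0"
  defines "z \<equiv> lift (c + r *\<^sub>R u) + t *s (lift ((2 * r) *\<^sub>R w) - lift 0) + t\<^sup>2 *s lift (c - r *\<^sub>R u)"
  shows "z \<noteq> 0" "abs_cp3 z \<in> pcl ({x. a \<bullet> x = b} \<inter> sphere c r)"
proof -
  show nz: "z \<noteq> 0"
  proof
    \<comment> \<open>The fourth coordinate gives \<open>t\<^sup>2 = - 1\<close>, and then the others give \<open>u + t w = 0\<close>, whose product
      with \<open>u\<close> would be 1.\<close>
    assume 0: "z = 0"
    have zi: "z $ 1 = 0" "z $ 2 = 0" "z $ 3 = 0" "z $ 4 = 0"
      by (simp_all add: 0)
    have t2: "t\<^sup>2 = -1"
      using zi(4) by (simp add: z_def eq_neg_iff_add_eq_0 add.commute)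
    have "2 * of_real r * (of_real (u $ i) + t * of_real (w $ i)) = 0" if "i \<in> {1, 2, 3}" for i
      using zi that unfolding z_def by (auto simp: t2 algebra_simps)
    then have "of_real (u $ i) + t * of_real (w $ i) = 0" for i
      using assms(1) exhaust_3[of i] by auto
    then have "0 = (\<Sum>i\<in>UNIV. of_real (u $ i) * (of_real (u $ i) + t * of_real (w $ i)))"
      by simp
    also have "\<dots> = of_real (u \<bullet> u) + t * of_real (u \<bullet> w)"
      by (simp add: inner_vec_def sum_3 algebra_simps)
    also have "\<dots> = 1"
      using orthonormal by (simp add: norm_eq_1)
    finally show False by simp
  qed
  have "\<exists>x\<in>{x. a \<bullet> x = b} \<inter> sphere c r. \<exists>k.
      lift (c + r *\<^sub>R u) + s *s (lift ((2 * r) *\<^sub>R w) - lift 0) + s\<^sup>2 *s lift (c - r *\<^sub>R u) = k *s lift x"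
    if "s \<in> \<real>" for s
  proof -
    obtain v where v: "s = of_real v"
      using \<open>s \<in> \<real>\<close> by (auto elim: Reals_cases)
    have pos: "1 + v\<^sup>2 > 0" 
      by (simp add: add_pos_nonneg)
    define p where "p = (1 - v\<^sup>2) / (1 + v\<^sup>2)"
    define q where "q = 2 * v / (1 + v\<^sup>2)"
    have pq: "(1 + v\<^sup>2) * p = 1 - v\<^sup>2" "(1 + v\<^sup>2) * q = 2 * v"
      using pos by (simp_all add: p_def q_def)
    have "(1 + v\<^sup>2)\<^sup>2 * (p\<^sup>2 + q\<^sup>2) = (1 + v\<^sup>2)\<^sup>2"
      unfolding distrib_left power_mult_distrib[symmetric] pq
      by (simp add: power2_eq_square algebra_simps)
    then have unit: "p\<^sup>2 + q\<^sup>2 = 1"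
      using pos by simp
    define x where "x = c + r *\<^sub>R (p *\<^sub>R u + q *\<^sub>R w)"
    have "(norm (p *\<^sub>R u + q *\<^sub>R w))\<^sup>2 = p\<^sup>2 + q\<^sup>2"
      unfolding power2_norm_eq_inner using orthonormal
      by (simp add: inner_add norm_eq_1 inner_commute power2_eq_square)
    then have "norm (p *\<^sub>R u + q *\<^sub>R w) = 1"
      by (simp add: unit power2_eq_1_iff) (smt (verit) norm_ge_zero)
    then have "x \<in> {x. a \<bullet> x = b} \<inter> sphere c r"
      using assms(1) on by (simp add: x_def dist_norm inner_add)
    moreover have "(1 + v\<^sup>2) * x $ i
        = c $ i + r * u $ i + v * (2 * r * w $ i) + v\<^sup>2 * (c $ i - r * u $ i)" for i
    proof -
      have "(1 + v\<^sup>2) * x $ i = (1 + v\<^sup>2) * c $ i + r * (((1 + v\<^sup>2) * p) * u $ i + ((1 + v\<^sup>2) * q) * w $ i)"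
        by (simp add: x_def algebra_simps)
      then show ?thesis
        unfolding pq by (simp add: algebra_simps)
    qed
    then have "of_real (1 + v\<^sup>2) * of_real (x $ i) = complex_of_real ((c + r *\<^sub>R u) $ i)
        + of_real v * of_real (((2 * r) *\<^sub>R w) $ i) + (of_real v)\<^sup>2 * of_real ((c - r *\<^sub>R u) $ i)" for i
      unfolding of_real_mult[symmetric] of_real_add[symmetric] of_real_power[symmetric] of_real_eq_iff
      by simp
    note comp = this
    have "lift (c + r *\<^sub>R u) + s *s (lift ((2 * r) *\<^sub>R w) - lift 0) + s\<^sup>2 *s lift (c - r *\<^sub>R u)
        = of_real (1 + v\<^sup>2) *s lift x"
      unfolding vec_eq_iff forall_4 v vector_add_component vector_minus_component
        vector_smult_component lift_nth zero_index of_real_0 diff_zero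
      using comp[of 1] comp[of 2] comp[of 3] by simp
    ultimately show ?thesis by blast
  qed
  moreover have "infinite (\<real> :: complex set)"
    using infinite_UNIV_char_0[where 'a = real] unfolding Reals_def
    by (simp add: finite_image_iff inj_on_def)
  ultimately show "abs_cp3 z \<in> pcl ({x. a \<bullet> x = b} \<inter> sphere c r)"
    using quadratic_curve_in_pcl[of \<real>] nz unfolding z_def by blast
qed

lemma orthonormal_frame:
  fixes a :: "real^3"
  obtains u w where "a \<bullet> u = 0" "a \<bullet> w = 0" "norm u = 1" "norm w = 1" "u \<bullet> w = 0"
proof -
  obtain u' where u': "u' \<noteq> 0" "orthogonal a u'"
    using orthogonal_to_vector_exists[of a] by auto
  have "dim {a, u'} < DIM(real^3)"
    using dim_le_card'[of "{a, u'}"] card_insert_le_m1[of 2 "{u'}" a] by simp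
  then obtain w' where w': "w' \<noteq> 0" "\<And>y. y \<in> span {a, u'} \<Longrightarrow> orthogonal w' y"
    by (rule orthogonal_to_subspace_exists) blast
  have "orthogonal w' a" "orthogonal w' u'"
    by (auto intro: w' span_base)
  then show thesis
    using u' w' by (intro that[of "u' /\<^sub>R norm u'" "w' /\<^sub>R norm w'"])
      (auto simp: orthogonal_def inner_commute)
qed

text \<open>Substituting the rational parametrization into the equation of the second plane gives a complex
  polynomial in the parameter. Its leading coefficient is the value at the real point
  \<open>c - r u\<close> of the circle (the parameter \<open>\<infinity>\<close>), hence nonzero, so the polynomial has degree 2 and
  a root.\<close>

lemma pcl_circle_meets_pcl_plane:
  assumes "is_plane P" "circle_in P C" "is_plane P'" "C \<inter> P' = {}"
  shows "pcl C \<inter> pcl P' \<noteq> {}"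
proof -
  obtain a b where P: "a \<noteq> 0" "P = {x. a \<bullet> x = b}"
    using assms(1) by (rule is_planeE)
  obtain a' b' where P': "a' \<noteq> 0" "P' = {x. a' \<bullet> x = b'}"
    using assms(3) by (rule is_planeE)
  obtain c r where C: "r > 0" "c \<in> P" "C = P \<inter> sphere c r"
    using assms(2) by (rule circle_inE)
  obtain u w where uw: "a \<bullet> u = 0" "a \<bullet> w = 0" "norm u = 1" "norm w = 1" "u \<bullet> w = 0"
    by (rule orthonormal_frame)
  define z where "z t = lift (c + r *\<^sub>R u) + t *s (lift ((2 * r) *\<^sub>R w) - lift 0)
    + t\<^sup>2 *s lift (c - r *\<^sub>R u)" for t :: complex
  have z: "z t \<noteq> 0" "abs_cp3 (z t) \<in> pcl C" for t
    using circle_curve_in_pcl[of r a c b u w t] C P uw by (auto simp: z_def)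
  define k where "k v = complex_of_real (a' \<bullet> v - b')" for v
  have form: "plane_form a' b' (z t)
      = poly [:k (c + r *\<^sub>R u), k ((2 * r) *\<^sub>R w) - k 0, k (c - r *\<^sub>R u):] t" for t
    unfolding diff_conv_add_uminus[of "lift _"] z_def plane_form_add plane_form_scale
      vector_sneg_minus1[of "lift _"] plane_form_lift k_def
    by (simp add: power2_eq_square algebra_simps)
  have "c - r *\<^sub>R u \<in> C"
    using C P uw by (auto simp: dist_norm inner_diff)
  then have "k (c - r *\<^sub>R u) \<noteq> 0"
    using assms(4) P' by (auto simp: k_def simp del: of_real_diff)
  then have "degree [:k (c + r *\<^sub>R u), k ((2 * r) *\<^sub>R w) - k 0, k (c - r *\<^sub>R u):] = 2"
    by simp
  then obtain t where "plane_form a' b' (z t) = 0"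
    using alg_closed_imp_poly_has_root[of "[:k (c + r *\<^sub>R u), k ((2 * r) *\<^sub>R w) - k 0, k (c - r *\<^sub>R u):]"]
    by (auto simp: form)
  then have "abs_cp3 (z t) \<in> pcl P'"
    using complex_plane_in_pcl[of a' "z t" b'] P' z by simp
  with z show ?thesis by blast
qed

section \<open>Circles without real points on the common line\<close>

definition plane_coeffs :: "real^3 \<Rightarrow> real \<Rightarrow> real^4" where
  "plane_coeffs a b = vector [a $ 1, a $ 2, a $ 3, - b]"

lemma plane_coeffs_nth [simp]:
  "plane_coeffs a b $ 1 = a $ 1" "plane_coeffs a b $ 2 = a $ 2" "plane_coeffs a b $ 3 = a $ 3"
  "plane_coeffs a b $ 4 = - b"
  by (simp_all add: plane_coeffs_def vector_def)

text \<open>Proportional equations would describe the same plane.\<close>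

lemma distinct_planes_independent:
  fixes a a' :: "real^3"
  assumes "a \<noteq> 0" "a' \<noteq> 0" "{x. a \<bullet> x = b} \<noteq> {x. a' \<bullet> x = b'}"
  shows "independent {plane_coeffs a b, plane_coeffs a' b'}"
    "plane_coeffs a b \<noteq> plane_coeffs a' b'"
proof -
  let ?l = "plane_coeffs a b" and ?l' = "plane_coeffs a' b'"
  have "?l' \<noteq> 0"
    using assms(2) by (auto simp: vec_eq_iff forall_4 forall_3)
  moreover have "?l \<notin> span {?l'}"
  proof
    assume "?l \<in> span {?l'}"
    then obtain k where "?l = k *\<^sub>R ?l'"
      by (auto simp: span_singleton)
    then have k: "a = k *\<^sub>R a'" "b = k * b'"
      by (auto simp: vec_eq_iff forall_4 forall_3)
    then have "k \<noteq> 0" using assms(1) by auto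
    then have "{x. a \<bullet> x = b} = {x. a' \<bullet> x = b'}"
      by (auto simp: k)
    with assms(3) show False ..
  qed
  ultimately show "independent {?l, ?l'}" "?l \<noteq> ?l'"
    using span_base[of ?l' "{?l'}"] by (auto simp: independent_insert)
qed

lemma plane_form_real_vec:
  "plane_form a b (real_vec v) = of_real (plane_coeffs a b \<bullet> v)"
  by (simp add: plane_form_def real_vec_def inner_vec_def sum_4)

text \<open>The homogeneous equations of the two planes are independent, so their common real solutions form
  the plane spanned by any two independent ones. This treats parallel planes, whose common line is at
  infinity, like all others.\<close>

lemma distinct_planes_common_zeros:
  assumes "a \<noteq> 0" "a' \<noteq> 0" "{x. a \<bullet> x = b} \<noteq> {x. a' \<bullet> x = b'}"
    and "independent {x, y}" "x \<noteq> y"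
    and zeros: "plane_form a b (real_vec x) = 0" "plane_form a b (real_vec y) = 0"
      "plane_form a' b' (real_vec x) = 0" "plane_form a' b' (real_vec y) = 0"
      "plane_form a b (real_vec v) = 0" "plane_form a' b' (real_vec v) = 0"
  shows "\<exists>p q. v = p *\<^sub>R x + q *\<^sub>R y"
proof -
  define l l' where "l = plane_coeffs a b" and "l' = plane_coeffs a' b'"
  define K where "K = {v \<in> UNIV. \<forall>x\<in>span {l, l'}. orthogonal x v}"
  have K: "v \<in> K" if "plane_form a b (real_vec v) = 0" "plane_form a' b' (real_vec v) = 0" for v
  proof -
    have "orthogonal v x" if "x \<in> span {l, l'}" for x
    proof (rule orthogonal_to_span[OF \<open>x \<in> span {l, l'}\<close>])
      show "orthogonal v w" if "w \<in> {l, l'}" for w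
        using that \<open>plane_form a b (real_vec v) = 0\<close> \<open>plane_form a' b' (real_vec v) = 0\<close>
        by (auto simp: plane_form_real_vec l_def l'_def orthogonal_def inner_commute)
    qed
    then show ?thesis
      by (auto simp: K_def orthogonal_commute)
  qed
  have "dim {l, l'} = card {l, l'}"
    unfolding l_def l'_def by (rule dim_eq_card_independent[OF distinct_planes_independent(1)[OF assms(1-3)]])
  also have "\<dots> = 2"
    using distinct_planes_independent(2)[OF assms(1-3)] by (simp add: l_def l'_def)
  finally have "dim (span {l, l'}) = 2"
    by (simp only: dim_span)
  then have "dim K = 2"
    using dim_subspace_orthogonal_to_vectors[OF subspace_span subspace_UNIV subset_UNIV, of "{l, l'}"]
    unfolding K_def by simp
  moreover have "{x, y} \<subseteq> K"
    using K[OF zeros(1,3)] K[OF zeros(2,4)] by blast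
  moreover have "card {x, y} = 2"
    using assms(5) by simp
  ultimately have "K \<subseteq> span {x, y}"
    using assms(4) by (metis card_ge_dim_independent order_refl)
  then have "v \<in> span {x, y}"
    using K[OF zeros(5,6)] by blast
  then obtain p where "v - p *\<^sub>R x \<in> span {y}"
    unfolding span_breakdown_eq[of v] by blast
  then obtain q where "v - p *\<^sub>R x = q *\<^sub>R y"
    by (auto simp: span_singleton)
  then have "v = p *\<^sub>R x + q *\<^sub>R y"
    by (simp add: algebra_simps)
  then show ?thesis by blast
qed

lemma sphere_form_combination:
  "sphere_form c r (\<alpha> *s z + \<beta> *s w) = \<alpha>\<^sup>2 * sphere_form c r z + \<beta>\<^sup>2 * sphere_form c r w
     + \<alpha> * \<beta> * (sphere_form c r (z + w) - sphere_form c r z - sphere_form c r w)"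
  unfolding sphere_form_def vector_add_component vector_smult_component by algebra

text \<open>The point \<open>z\<close> and its conjugate are not real, hence distinct, and they span the line. At
  \<open>\<alpha> z + \<beta> cnj z\<close> the equation of the sphere takes the value \<open>\<alpha> \<beta> k\<close>, where \<open>k\<close> is its value at the
  real point \<open>z + cnj z\<close>. As the circle has no real point on the line, \<open>k\<close> is nonzero, and only
  \<open>\<alpha> = 0\<close> and \<open>\<beta> = 0\<close> give zeros.\<close>

lemma conic_line_conjugate_points:
  assumes planes: "is_plane P" "is_plane P'" "P \<noteq> P'" and circle: "circle_in P C"
    and empty: "C \<inter> P' = {}"
    and z: "z \<noteq> 0" "abs_cp3 z \<in> pcl C \<inter> pcl P'"
  shows "pcl C \<inter> pcl P' = {abs_cp3 z, abs_cp3 (cnj_vec z)}"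
proof -
  obtain a b where P: "a \<noteq> 0" "P = {x. a \<bullet> x = b}"
    using planes(1) by (rule is_planeE)
  obtain a' b' where P': "a' \<noteq> 0" "P' = {x. a' \<bullet> x = b'}"
    using planes(2) by (rule is_planeE)
  obtain c r where C: "r > 0" "C = P \<inter> sphere c r"
    using circle by (rule circle_inE)
  have form: "plane_form a b w = 0" "plane_form a' b' w = 0" "sphere_form c r w = 0"
    if "w \<noteq> 0" "abs_cp3 w \<in> pcl C \<inter> pcl P'" for w
    using that plane_form_pcl[of w C a b] plane_form_pcl[of w P' a' b'] sphere_form_pcl[of w C c r]
    by (auto simp: C(2) P(2) P'(2))
  \<comment> \<open>A real common zero of the three forms would be a point of the circle in the other plane.\<close>
  have no_real: "v = 0" if v: "plane_form a b (real_vec v) = 0" "plane_form a' b' (real_vec v) = 0"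
    "sphere_form c r (real_vec v) = 0" for v
  proof (rule ccontr)
    assume "v \<noteq> 0"
    then have v4: "v $ 4 \<noteq> 0"
      using real_zero_of_sphere_form v(3) by blast
    then obtain x where x: "real_vec v = of_real (v $ 4) *s lift x"
      by (rule real_vec_finite_point)
    have "a \<bullet> x = b" "a' \<bullet> x = b'" "sphere_form c r (lift x) = 0"
      using v v4 unfolding x
      by (simp_all add: plane_form_scale plane_form_lift hom_poly_homogeneous[OF hom_poly_sphere_form])
    then have "x \<in> C \<inter> P'"
      by (simp add: C P P' sphere_form_lift_eq_0_iff[OF C(1)] del: mem_sphere)
    with empty show False by blast
  qed
  define x :: "complex^4 \<Rightarrow> real^4" where "x w = (\<chi> i. Re (w $ i))" for w
  define y :: "complex^4 \<Rightarrow> real^4" where "y w = (\<chi> i. Im (w $ i))" for w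
  have split: "w = real_vec (x w) + \<i> *s real_vec (y w)" for w
    by (simp add: vec_eq_iff x_def y_def real_vec_def complex_eq_iff)
  have parts: "plane_form a b (real_vec (x w)) = 0" "plane_form a b (real_vec (y w)) = 0"
    if "plane_form a b w = 0" for a b w
    using that by (simp_all add: plane_form_def x_def y_def real_vec_def complex_eq_iff)
  \<comment> \<open>Hence the point is not a complex multiple of a real vector.\<close>
  have dep: "v = 0" if v: "x z = p *\<^sub>R v" "y z = q *\<^sub>R v" for v p q
  proof -
    have zv: "z = Complex p q *s real_vec v"
      by (subst split) (simp add: v vec_eq_iff real_vec_def complex_eq_iff)
    then have "Complex p q \<noteq> 0" using z(1) by auto
    then show ?thesis
      using form[OF z] unfolding zv
      by (intro no_real) (simp_all add: plane_form_scale hom_poly_homogeneous[OF hom_poly_sphere_form])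
  qed
  have "y z \<noteq> 0"
    using dep[of 1 "x z" 0] z(1) by (auto simp: x_def y_def vec_eq_iff complex_eq_iff)
  moreover have "x z \<notin> span {y z}"
    using dep[of _ "y z" 1] \<open>y z \<noteq> 0\<close> by (auto simp: span_singleton)
  ultimately have ind: "independent {x z, y z}" "x z \<noteq> y z"
    using span_base[of "y z" "{y z}"] by (auto simp: independent_insert)
  have cnj_z: "abs_cp3 (cnj_vec z) \<in> pcl C \<inter> pcl P'"
    using z pcl_cnj by blast
  have "abs_cp3 w = abs_cp3 z \<or> abs_cp3 w = abs_cp3 (cnj_vec z)"
    if w: "w \<noteq> 0" "abs_cp3 w \<in> pcl C \<inter> pcl P'" for w
  proof -
    have neq: "{x. a \<bullet> x = b} \<noteq> {x. a' \<bullet> x = b'}"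
      using planes(3) unfolding P P' .
    have span: "\<exists>p q. v = p *\<^sub>R x z + q *\<^sub>R y z"
      if "plane_form a b (real_vec v) = 0" "plane_form a' b' (real_vec v) = 0" for v
      using distinct_planes_common_zeros[OF P(1) P'(1) neq ind
          parts[OF form(1)[OF z]] parts[OF form(2)[OF z]] that] .
    obtain p q where x_eq: "x w = p *\<^sub>R x z + q *\<^sub>R y z"
      using span[OF parts(1)[OF form(1)[OF w]] parts(1)[OF form(2)[OF w]]] by blast
    obtain p' q' where y_eq: "y w = p' *\<^sub>R x z + q' *\<^sub>R y z"
      using span[OF parts(2)[OF form(1)[OF w]] parts(2)[OF form(2)[OF w]]] by blast
    define \<alpha> where "\<alpha> = (Complex p p' - \<i> * Complex q q') / 2"
    define \<beta> where "\<beta> = (Complex p p' + \<i> * Complex q q') / 2"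
    have xz: "real_vec (x z) = (1 / 2) *s (z + cnj_vec z)"
      and yz: "real_vec (y z) = (- \<i> / 2) *s (z - cnj_vec z)"
      by (simp_all add: vec_eq_iff x_def y_def real_vec_def cnj_vec_def complex_eq_iff)
    have "w = Complex p p' *s real_vec (x z) + Complex q q' *s real_vec (y z)"
      by (subst split) (simp add: x_eq y_eq vec_eq_iff real_vec_def complex_eq_iff)
    also have "\<dots> = \<alpha> *s z + \<beta> *s cnj_vec z"
    proof -
      have "A * ((1 / 2) * (k + l)) + B * ((- \<i> / 2) * (k - l)) = (A - \<i> * B) / 2 * k + (A + \<i> * B) / 2 * l"
        for A B k l by (simp add: algebra_simps add_divide_distrib diff_divide_distrib)
      then show ?thesis
        unfolding xz yz \<alpha>_def \<beta>_def vec_eq_iff vector_add_component vector_minus_component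
          vector_smult_component by blast
    qed
    finally have w_eq: "w = \<alpha> *s z + \<beta> *s cnj_vec z" .
    have "z + cnj_vec z = real_vec (2 *\<^sub>R x z)"
      by (simp add: vec_eq_iff x_def real_vec_def cnj_vec_def complex_eq_iff)
    moreover have "plane_form a b (z + cnj_vec z) = 0" "plane_form a' b' (z + cnj_vec z) = 0"
      using form[OF z] by (simp_all add: plane_form_add plane_form_cnj)
    moreover have "x z \<noteq> 0"
      using ind(1) dependent_zero by (metis insertI1)
    ultimately have "sphere_form c r (z + cnj_vec z) \<noteq> 0"
      using no_real[of "2 *\<^sub>R x z"] by auto
    moreover have "sphere_form c r z = 0" "sphere_form c r (cnj_vec z) = 0"
      using form[OF z] by (simp_all add: sphere_form_cnj)
    ultimately have "\<alpha> = 0 \<or> \<beta> = 0"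
      using form(3)[OF w] unfolding w_eq sphere_form_combination by simp
    then have "(\<exists>k. w = k *s z) \<or> (\<exists>k. w = k *s cnj_vec z)"
      using w_eq by auto
    moreover have "abs_cp3 z = abs_cp3 w \<longleftrightarrow> (\<exists>k. w = k *s z)"
      "abs_cp3 (cnj_vec z) = abs_cp3 w \<longleftrightarrow> (\<exists>k. w = k *s cnj_vec z)"
      using w(1) z(1) by (simp_all only: abs_cp3_eq_iff cnj_vec_nonzero not_False_eq_True)
    ultimately show ?thesis
      by metis
  qed
  then have "p = abs_cp3 z \<or> p = abs_cp3 (cnj_vec z)" if "p \<in> pcl C \<inter> pcl P'" for p
    by (cases p rule: cp3_cases) (use that in simp)
  then show ?thesis
    using z(2) cnj_z by (intro subset_antisym subsetI) auto
qed

text \<open>Each circle cuts the line in a pair of conjugate points, and two such pairs that have a common point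
  are equal. The alternatives exclude each other because the pairs are not empty.\<close>

lemma disjoint_or_conjugate:
  assumes pair: "circle_pair P1 C1 P2 C2" and empty: "C1 \<inter> P2 = {}" "C2 \<inter> P1 = {}"
  shows "(pcl C1 \<inter> pcl C2 = {}) \<noteq>
    (pcl C1 \<inter> (pcl P1 \<inter> pcl P2) = pcl C2 \<inter> (pcl P1 \<inter> pcl P2))"
proof -
  have planes: "is_plane P1" "is_plane P2" "P1 \<noteq> P2" and circles: "circle_in P1 C1" "circle_in P2 C2"
    using pair by (auto simp: circle_pair_def)
  have "pcl C1 \<subseteq> pcl P1" "pcl C2 \<subseteq> pcl P2"
    using circles by (auto intro!: pcl_mono elim!: circle_inE)
  then have on_line: "pcl C1 \<inter> (pcl P1 \<inter> pcl P2) = pcl C1 \<inter> pcl P2"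
    "pcl C2 \<inter> (pcl P1 \<inter> pcl P2) = pcl C2 \<inter> pcl P1"
    and common: "pcl C1 \<inter> pcl C2 = (pcl C1 \<inter> pcl P2) \<inter> (pcl C2 \<inter> pcl P1)"
    by blast+
  have "pcl C1 \<inter> pcl P2 \<noteq> {}"
    by (rule pcl_circle_meets_pcl_plane[OF planes(1) circles(1) planes(2) empty(1)])
  moreover have "pcl C1 \<inter> pcl P2 = pcl C2 \<inter> pcl P1" if meet: "pcl C1 \<inter> pcl C2 \<noteq> {}"
  proof -
    obtain p where p: "p \<in> pcl C1 \<inter> pcl P2" "p \<in> pcl C2 \<inter> pcl P1"
      using meet common by blast
    obtain z where "z \<noteq> 0" "p = abs_cp3 z"
      by (rule cp3_cases)
    then show ?thesis
      using p conic_line_conjugate_points[OF planes circles(1) empty(1), of z]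
        conic_line_conjugate_points[OF planes(2,1) planes(3)[symmetric] circles(2) empty(2), of z]
      by simp
  qed
  ultimately show ?thesis
    unfolding on_line common by blast
qed

section \<open>Label sequences in real space\<close>

text \<open>The direction is the cross product of the normals. It also describes the vectors along which both
  planes are invariant, among which the order of a label sequence picks one.\<close>

lemma planes_meet_in_line:
  assumes "is_plane P" "is_plane P'" "P \<noteq> P'" "q \<in> P" "q \<in> P'"
  obtains d where "d \<noteq> 0" "P \<inter> P' = range (\<lambda>t. q + t *\<^sub>R d)"
    "\<And>v. (\<forall>x\<in>P. x + v \<in> P) \<and> (\<forall>x\<in>P'. x + v \<in> P') \<longleftrightarrow> (\<exists>t. v = t *\<^sub>R d)"
proof -
  obtain a b where P: "a \<noteq> 0" "P = {x. a \<bullet> x = b}"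
    using assms(1) by (rule is_planeE)
  obtain a' b' where P': "a' \<noteq> 0" "P' = {x. a' \<bullet> x = b'}"
    using assms(2) by (rule is_planeE)
  define d where "d = cross3 a a'"
  have ad: "a \<bullet> d = 0" "a' \<bullet> d = 0"
    by (simp_all add: d_def dot_cross_self)
  have d: "d \<noteq> 0"
  proof
    assume "d = 0"
    then obtain k where k: "a' = k *\<^sub>R a"
      using P(1) P'(1) by (auto simp: d_def cross_eq_0 collinear_lemma)
    then have "k \<noteq> 0" using P'(1) by auto
    then have "P = P'"
      using assms(4,5) by (auto simp: P P' k)
    with assms(3) show False ..
  qed
  have parallel: "\<exists>t. v = t *\<^sub>R d" if v: "a \<bullet> v = 0" "a' \<bullet> v = 0" for v
  proof -
    have "cross3 v d = 0"
      unfolding d_def Lagrange using v by (simp add: inner_commute)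
    then have "v = 0 \<or> (\<exists>k. d = k *\<^sub>R v)"
      using d by (simp add: cross_eq_0 collinear_lemma)
    then show ?thesis
    proof
      assume "\<exists>k. d = k *\<^sub>R v"
      then obtain k where k: "d = k *\<^sub>R v" by blast
      then have "v = inverse k *\<^sub>R d" using d by auto
      then show ?thesis by blast
    qed (auto intro: exI[of _ 0])
  qed
  show thesis
  proof
    show "d \<noteq> 0" by (rule d)
    show "P \<inter> P' = range (\<lambda>t. q + t *\<^sub>R d)"
    proof
      show "P \<inter> P' \<subseteq> range (\<lambda>t. q + t *\<^sub>R d)"
      proof
        fix x assume "x \<in> P \<inter> P'"
        then obtain t where "x - q = t *\<^sub>R d"
          using parallel[of "x - q"] assms(4,5) by (auto simp: P P' inner_diff_right)
        then have "x = q + t *\<^sub>R d" by (simp add: algebra_simps)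
        then show "x \<in> range (\<lambda>t. q + t *\<^sub>R d)" by blast
      qed
      show "range (\<lambda>t. q + t *\<^sub>R d) \<subseteq> P \<inter> P'"
        using assms(4,5) ad by (auto simp: P P' inner_add_right)
    qed
    show "(\<forall>x\<in>P. x + v \<in> P) \<and> (\<forall>x\<in>P'. x + v \<in> P') \<longleftrightarrow> (\<exists>t. v = t *\<^sub>R d)" for v
    proof
      assume "(\<forall>x\<in>P. x + v \<in> P) \<and> (\<forall>x\<in>P'. x + v \<in> P')"
      then have "q + v \<in> P" "q + v \<in> P'"
        using assms(4,5) by blast+
      then show "\<exists>t. v = t *\<^sub>R d"
        using assms(4,5) by (intro parallel) (auto simp: P P' inner_add_right)
    qed (use ad in \<open>auto simp: P P' inner_add_right\<close>)
  qed
qed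

text \<open>On a line, the equation of a sphere is quadratic with leading coefficient \<open>d \<bullet> d\<close>.\<close>

lemma line_meets_sphere:
  fixes q d c :: "'a::real_inner"
  assumes "d \<noteq> 0"
  shows "finite (range (\<lambda>t. q + t *\<^sub>R d) \<inter> sphere c r)"
    "card (range (\<lambda>t. q + t *\<^sub>R d) \<inter> sphere c r) \<le> 2"
proof -
  define p where "p = [:(q - c) \<bullet> (q - c) - r\<^sup>2, 2 * ((q - c) \<bullet> d), d \<bullet> d:]"
  have p: "p \<noteq> 0" "degree p = 2"
    using assms by (simp_all add: p_def)
  have sub: "range (\<lambda>t. q + t *\<^sub>R d) \<inter> sphere c r \<subseteq> (\<lambda>t. q + t *\<^sub>R d) ` {t. poly p t = 0}"
  proof
    fix x assume "x \<in> range (\<lambda>t. q + t *\<^sub>R d) \<inter> sphere c r"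
    then obtain t where t: "x = q + t *\<^sub>R d" "dist c x = r" by auto
    have "x - c = (q - c) + t *\<^sub>R d"
      using t(1) by simp
    have "r\<^sup>2 = (x - c) \<bullet> (x - c)"
      unfolding t(2)[symmetric] dist_commute[of c] by (simp add: dist_norm power2_norm_eq_inner)
    also have "\<dots> = (q - c) \<bullet> (q - c) + t * (2 * ((q - c) \<bullet> d) + t * (d \<bullet> d))"
    proof -
      have "(e + t *\<^sub>R d) \<bullet> (e + t *\<^sub>R d) = e \<bullet> e + t * (2 * (e \<bullet> d) + t * (d \<bullet> d))" for e
        by (simp add: inner_add_left inner_add_right inner_commute[of d e] distrib_left)
      then show ?thesis
        unfolding \<open>x - c = (q - c) + t *\<^sub>R d\<close> .
    qed
    finally have "poly p t = 0"
      by (simp add: p_def)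
    with t(1) show "x \<in> (\<lambda>t. q + t *\<^sub>R d) ` {t. poly p t = 0}" by blast
  qed
  have fin: "finite {t. poly p t = 0}"
    by (rule poly_roots_finite[OF p(1)])
  show "finite (range (\<lambda>t. q + t *\<^sub>R d) \<inter> sphere c r)"
    using sub fin finite_surj by blast
  have "card (range (\<lambda>t. q + t *\<^sub>R d) \<inter> sphere c r) \<le> card {t. poly p t = 0}"
    by (rule surj_card_le[OF fin sub])
  also have "\<dots> \<le> 2"
    using card_poly_roots_bound[OF p(1)] p(2) by simp
  finally show "card (range (\<lambda>t. q + t *\<^sub>R d) \<inter> sphere c r) \<le> 2" .
qed

lemma circle_meets_plane_finite:
  assumes "is_plane P" "is_plane P'" "P \<noteq> P'" "circle_in P C"
  shows "finite (C \<inter> P')" "card (C \<inter> P') \<le> 2"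
proof -
  have "finite (C \<inter> P') \<and> card (C \<inter> P') \<le> 2"
  proof (cases "C \<inter> P' = {}")
    case False
    obtain c r where C: "C = P \<inter> sphere c r"
      using assms(4) by (rule circle_inE)
    with False obtain q where q: "q \<in> P" "q \<in> P'" by blast
    obtain d where d: "d \<noteq> 0" "P \<inter> P' = range (\<lambda>t. q + t *\<^sub>R d)"
      using planes_meet_in_line[OF assms(1-3) q] by metis
    have "C \<inter> P' = range (\<lambda>t. q + t *\<^sub>R d) \<inter> sphere c r"
      unfolding C d(2)[symmetric] by blast
    with line_meets_sphere[OF d(1), of q c r] show ?thesis by simp
  qed simp
  then show "finite (C \<inter> P')" "card (C \<inter> P') \<le> 2" by blast+
qed

definition point_label :: "(real^3) set \<Rightarrow> (real^3) set \<Rightarrow> real^3 \<Rightarrow> label" where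
  "point_label C1 C2 x = (if x \<in> C1 \<inter> C2 then S else if x \<in> C1 then L1 else L2)"

text \<open>The closures add no real points to circles and planes, so label sequences can be read off from the
  circles in real space.\<close>

lemma label_sequence_real_iff:
  assumes "circle_pair P1 C1 P2 C2"
  shows "label_sequence P1 C1 P2 C2 xs \<longleftrightarrow> (\<exists>v ps. v \<noteq> 0 \<and>
    ((\<forall>x\<in>P1. x + v \<in> P1) \<and> (\<forall>x\<in>P2. x + v \<in> P2)) \<and>
    sorted_wrt (\<lambda>x y. x \<bullet> v < y \<bullet> v) ps \<and> set ps = (C1 \<inter> P2) \<union> (C2 \<inter> P1) \<and>
    xs = map (point_label C1 C2) ps)"
proof -
  have planes: "is_plane P1" "is_plane P2" and circles: "circle_in P1 C1" "circle_in P2 C2"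
    using assms by (auto simp: circle_pair_def)
  have "pcl C1 \<subseteq> pcl P1" "pcl C2 \<subseteq> pcl P2"
    using circles by (auto intro!: pcl_mono elim!: circle_inE)
  then have "(pcl C1 \<union> pcl C2) \<inter> (pcl P1 \<inter> pcl P2) \<inter> real_points
      = (pcl C1 \<inter> pcl P2 \<inter> real_points) \<union> (pcl C2 \<inter> pcl P1 \<inter> real_points)"
    by blast
  also have "\<dots> = of_affine ` ((C1 \<inter> P2) \<union> (C2 \<inter> P1))"
    using real_points_pcl_circle_plane[OF planes(1) circles(1) planes(2)]
      real_points_pcl_circle_plane[OF planes(2) circles(2) planes(1)] by blast
  finally have points: "(pcl C1 \<union> pcl C2) \<inter> (pcl P1 \<inter> pcl P2) \<inter> real_points
      = of_affine ` ((C1 \<inter> P2) \<union> (C2 \<inter> P1))" .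
  have label: "(\<lambda>x. label_of C1 C2 (of_affine x)) = point_label C1 C2"
    by (simp add: fun_eq_iff label_of_def point_label_def
        of_affine_in_pcl_circle_iff[OF planes(1) circles(1)]
        of_affine_in_pcl_circle_iff[OF planes(2) circles(2)])
  show ?thesis
    unfolding label_sequence_def points label inj_image_eq_iff[OF inj_of_affine] by blast
qed

lemma sorted_by_unique:
  fixes f :: "'a \<Rightarrow> 'b::linorder"
  assumes "sorted_wrt (\<lambda>x y. f x < f y) ps" "sorted_wrt (\<lambda>x y. f x < f y) qs" "set ps = set qs"
  shows "ps = qs"
proof -
  have *: "sorted_wrt (<) (map f ps)" "sorted_wrt (<) (map f qs)"
    using assms by (simp_all add: sorted_wrt_map)
  then have "map f ps = map f qs"
    using assms(3) by (intro strict_sorted_equal) auto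
  moreover have "inj_on f (set ps)"
    using *(1) by (simp add: strict_sorted_iff distinct_map)
  ultimately show ?thesis
    using assms(3) by (simp add: inj_on_map_eq_map)
qed

text \<open>The vector that orders the points is a multiple of a fixed direction of the line, and the sign of
  the factor decides between the two reading directions.\<close>

lemma label_sequence_unique:
  assumes pair: "circle_pair P1 C1 P2 C2"
    and xs: "label_sequence P1 C1 P2 C2 xs" and ys: "label_sequence P1 C1 P2 C2 ys"
    and q: "q \<in> P1 \<inter> P2"
  shows "ys = xs \<or> ys = rev xs"
proof -
  obtain d where d: "\<And>v. (\<forall>x\<in>P1. x + v \<in> P1) \<and> (\<forall>x\<in>P2. x + v \<in> P2) \<longleftrightarrow> (\<exists>t. v = t *\<^sub>R d)"
  proof -
    have "is_plane P1" "is_plane P2" "P1 \<noteq> P2" "q \<in> P1" "q \<in> P2"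
      using pair q by (simp_all add: circle_pair_def)
    then show thesis
      using that by (rule planes_meet_in_line)
  qed
  obtain s ps where ps: "s *\<^sub>R d \<noteq> 0" "sorted_wrt (\<lambda>x y. x \<bullet> (s *\<^sub>R d) < y \<bullet> (s *\<^sub>R d)) ps"
      "set ps = (C1 \<inter> P2) \<union> (C2 \<inter> P1)" "xs = map (point_label C1 C2) ps"
    using xs unfolding label_sequence_real_iff[OF pair] d by blast
  obtain t qs where qs: "t *\<^sub>R d \<noteq> 0" "sorted_wrt (\<lambda>x y. x \<bullet> (t *\<^sub>R d) < y \<bullet> (t *\<^sub>R d)) qs"
      "set qs = (C1 \<inter> P2) \<union> (C2 \<inter> P1)" "ys = map (point_label C1 C2) qs"
    using ys unfolding label_sequence_real_iff[OF pair] d by blast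
  have "s \<noteq> 0" "t \<noteq> 0" using ps(1) qs(1) by auto
  \<comment> \<open>With the sign of the factor, the order along the vector is that along the fixed direction
    or its opposite.\<close>
  have sorted: "sorted_wrt (\<lambda>x y. x \<bullet> d < y \<bullet> d) (if u > 0 then rs else rev rs)"
    if "u \<noteq> 0" "sorted_wrt (\<lambda>x y. x \<bullet> (u *\<^sub>R d) < y \<bullet> (u *\<^sub>R d)) rs" for u rs
    using that by (cases "u > 0") (auto simp: sorted_wrt_rev elim: sorted_wrt_mono_rel[rotated])
  have "(if s > 0 then ps else rev ps) = (if t > 0 then qs else rev qs)"
    by (rule sorted_by_unique[OF sorted[OF \<open>s \<noteq> 0\<close> ps(2)] sorted[OF \<open>t \<noteq> 0\<close> qs(2)]])
      (use ps(3) qs(3) in simp)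
  then have "qs = ps \<or> qs = rev ps"
    by (auto split: if_splits)
  then show ?thesis
    by (auto simp: ps(4) qs(4) rev_map)
qed

lemma label_sequence_exists:
  assumes pair: "circle_pair P1 C1 P2 C2" and q: "q \<in> P1 \<inter> P2"
  shows "\<exists>xs. label_sequence P1 C1 P2 C2 xs"
proof -
  have planes: "is_plane P1" "is_plane P2" "P1 \<noteq> P2" and circles: "circle_in P1 C1" "circle_in P2 C2"
    using pair by (auto simp: circle_pair_def)
  obtain d where d: "d \<noteq> 0" "P1 \<inter> P2 = range (\<lambda>t. q + t *\<^sub>R d)"
    "\<And>v. (\<forall>x\<in>P1. x + v \<in> P1) \<and> (\<forall>x\<in>P2. x + v \<in> P2) \<longleftrightarrow> (\<exists>t. v = t *\<^sub>R d)"
    using planes_meet_in_line[OF planes, of q] q by blast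
  define A where "A = (C1 \<inter> P2) \<union> (C2 \<inter> P1)"
  have "finite A"
    using circle_meets_plane_finite(1)[OF planes circles(1)]
      circle_meets_plane_finite(1)[OF planes(2,1) planes(3)[symmetric] circles(2)]
    by (simp add: A_def)
  have "A \<subseteq> range (\<lambda>t. q + t *\<^sub>R d)"
    using circles unfolding d(2)[symmetric] by (auto simp: A_def elim!: circle_inE)
  define T where "T = {t. q + t *\<^sub>R d \<in> A}"
  have A: "A = (\<lambda>t. q + t *\<^sub>R d) ` T"
    using \<open>A \<subseteq> _\<close> by (auto simp: T_def)
  have "inj_on (\<lambda>t. q + t *\<^sub>R d) T"
    using d(1) by (auto simp: inj_on_def)
  then have "finite T"
    using \<open>finite A\<close> by (simp add: A finite_image_iff)
  define ps where "ps = map (\<lambda>t. q + t *\<^sub>R d) (sorted_list_of_set T)"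
  have "sorted_wrt (\<lambda>s t. (q + s *\<^sub>R d) \<bullet> d < (q + t *\<^sub>R d) \<bullet> d) (sorted_list_of_set T)"
    by (rule sorted_wrt_mono_rel[OF _ strict_sorted_list_of_set]) (use d(1) in \<open>simp add: inner_add_left\<close>)
  then have "sorted_wrt (\<lambda>x y. x \<bullet> d < y \<bullet> d) ps"
    by (simp add: ps_def sorted_wrt_map)
  moreover have "set ps = A"
    using \<open>finite T\<close> by (simp add: ps_def A)
  moreover have "(\<forall>x\<in>P1. x + d \<in> P1) \<and> (\<forall>x\<in>P2. x + d \<in> P2)"
    unfolding d(3) by (rule exI[of _ 1]) simp
  ultimately show ?thesis
    using d(1) unfolding label_sequence_real_iff[OF pair] A_def by blast
qed

lemma label_sequence_swap:
  assumes pair: "circle_pair P1 C1 P2 C2" and "label_sequence P1 C1 P2 C2 xs"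
  shows "label_sequence P2 C2 P1 C1 (map swap_label xs)"
proof -
  have pair': "circle_pair P2 C2 P1 C1"
    using pair by (auto simp: circle_pair_def)
  obtain v ps where vps: "v \<noteq> 0" "(\<forall>x\<in>P1. x + v \<in> P1) \<and> (\<forall>x\<in>P2. x + v \<in> P2)"
    "sorted_wrt (\<lambda>x y. x \<bullet> v < y \<bullet> v) ps" "set ps = (C1 \<inter> P2) \<union> (C2 \<inter> P1)"
    "xs = map (point_label C1 C2) ps"
    using assms(2) unfolding label_sequence_real_iff[OF pair] by blast
  have "swap_label (point_label C1 C2 x) = point_label C2 C1 x" if "x \<in> set ps" for x
    using that unfolding vps(4) by (auto simp: point_label_def)
  then have "map swap_label xs = map (point_label C2 C1) ps"
    by (simp add: vps(5))
  then show ?thesis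
    using vps(1-4) unfolding label_sequence_real_iff[OF pair'] by blast
qed

definition on_first :: "label list \<Rightarrow> nat" where
  "on_first xs = length (filter (\<lambda>l. l \<noteq> L2) xs)"

definition on_second :: "label list \<Rightarrow> nat" where
  "on_second xs = length (filter (\<lambda>l. l \<noteq> L1) xs)"

text \<open>The points on the first circle are those not labelled \<open>L2\<close>, and those on the second are the ones
  not labelled \<open>L1\<close>; so \<open>S\<close> counts for both circles.\<close>

lemma label_sequence_counts:
  assumes pair: "circle_pair P1 C1 P2 C2" and "label_sequence P1 C1 P2 C2 xs"
  shows "on_first xs = card (C1 \<inter> P2)" "on_second xs = card (C2 \<inter> P1)"
proof -
  obtain v ps where vps: 
    "sorted_wrt (\<lambda>x y. x \<bullet> v < y \<bullet> v) ps" "set ps = (C1 \<inter> P2) \<union> (C2 \<inter> P1)"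
    "xs = map (point_label C1 C2) ps"
    using assms(2) unfolding label_sequence_real_iff[OF pair] by blast
  have "C1 \<subseteq> P1" "C2 \<subseteq> P2"
    using pair by (auto simp: circle_pair_def elim!: circle_inE)
  then have C: "C1 \<inter> P2 = {x \<in> set ps. x \<in> C1}" "C2 \<inter> P1 = {x \<in> set ps. x \<in> C2}"
    using vps(2) by blast+
  have "sorted_wrt (<) (map (\<lambda>x. x \<bullet> v) ps)"
    using vps(1) by (simp add: sorted_wrt_map)
  then have distinct: "distinct ps"
    by (simp add: strict_sorted_iff distinct_map)
  have count: "length (filter Q xs) = card {x \<in> set ps. x \<in> A}"
    if "\<And>x. x \<in> set ps \<Longrightarrow> Q (point_label C1 C2 x) \<longleftrightarrow> x \<in> A" for Q A
  proof -
    have "filter (Q \<circ> point_label C1 C2) ps = filter (\<lambda>x. x \<in> A) ps"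
      using that by (intro filter_cong) auto
    then show ?thesis
      using distinct_card[OF distinct_filter[OF distinct, of "\<lambda>x. x \<in> A"]]
      by (simp add: vps(3) filter_map)
  qed
  show "on_first xs = card (C1 \<inter> P2)"
    unfolding on_first_def C(1) by (rule count) (auto simp: point_label_def)
  show "on_second xs = card (C2 \<inter> P1)"
    unfolding on_second_def C(2) by (rule count) (use vps(2) in \<open>auto simp: point_label_def\<close>)
qed

section \<open>Uniqueness of the order type\<close>

lemma sequence_class_rev: "sequence_class m n (rev xs) = sequence_class m n xs"
  by (auto simp: sequence_class_def rev_map)

lemma swap_label_swap_label [simp]: "swap_label (swap_label l) = l"
  by (cases l) simp_all

lemma sequence_class_swap: "sequence_class m m (map swap_label xs) = sequence_class m m xs"
  by (auto simp: sequence_class_def rev_map comp_def)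

definition sequence_type :: "label list \<Rightarrow> order_type" where
  "sequence_type xs = Sequence (on_first xs) (on_second xs) (sequence_class (on_first xs) (on_second xs) xs)"

lemma counts_rev [simp]: "on_first (rev xs) = on_first xs" "on_second (rev xs) = on_second xs"
  by (simp_all add: on_first_def on_second_def flip: rev_filter)

lemma counts_swap [simp]:
  "on_first (map swap_label xs) = on_second xs" "on_second (map swap_label xs) = on_first xs"
proof -
  have "swap_label l \<noteq> L2 \<longleftrightarrow> l \<noteq> L1" "swap_label l \<noteq> L1 \<longleftrightarrow> l \<noteq> L2" for l
    by (cases l; simp)+
  then show "on_first (map swap_label xs) = on_second xs" "on_second (map swap_label xs) = on_first xs"
    by (simp_all add: on_first_def on_second_def filter_map comp_def)
qed

text \<open>Reversal and exchange of labels generate an equivalence relation whose classes are the sequence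
  classes; exchange is included only when it preserves the intersection type.\<close>

lemma sequence_type_eq_iff:
  "sequence_type xs = sequence_type ys \<longleftrightarrow> ys \<in> sequence_class (on_first xs) (on_second xs) xs"
proof
  assume "sequence_type xs = sequence_type ys"
  moreover have "ys \<in> sequence_class (on_first ys) (on_second ys) ys"
    by (simp add: sequence_class_def)
  ultimately show "ys \<in> sequence_class (on_first xs) (on_second xs) xs"
    unfolding sequence_type_def order_type.inject by metis
next
  assume "ys \<in> sequence_class (on_first xs) (on_second xs) xs"
  then consider "ys = xs" | "ys = rev xs" | "on_first xs = on_second xs" "ys = map swap_label xs"
    | "on_first xs = on_second xs" "ys = rev (map swap_label xs)"
    by (auto simp: sequence_class_def split: if_splits)
  then show "sequence_type xs = sequence_type ys"
    by cases (simp_all add: sequence_type_def sequence_class_rev sequence_class_swap)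
qed

lemma ordered_pair_type_sequence_iff:
  assumes pair: "circle_pair P1 C1 P2 C2"
    and xs: "label_sequence P1 C1 P2 C2 xs" "on_first xs > 0" "on_second xs \<le> on_first xs"
  shows "ordered_pair_type P1 C1 P2 C2 T \<longleftrightarrow> T = sequence_type xs"
proof -
  have planes: "is_plane P1" "is_plane P2" and circles: "circle_in P1 C1" "circle_in P2 C2"
    using pair by (auto simp: circle_pair_def)
  have counts: "num_real C1 P2 = on_first xs" "num_real C2 P1 = on_second xs"
    using num_real_eq_card[OF planes(1) circles(1) planes(2)] num_real_eq_card[OF planes(2) circles(2) planes(1)]
      label_sequence_counts[OF pair xs(1)] by simp_all
  have "C1 \<inter> P2 \<noteq> {}"
    using label_sequence_counts(1)[OF pair xs(1)] xs(2) by auto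
  then obtain q where q: "q \<in> P1 \<inter> P2"
    using circles(1) by (auto elim: circle_inE)
  show ?thesis
  proof
    assume "ordered_pair_type P1 C1 P2 C2 T"
    then show "T = sequence_type xs"
    proof cases
      case (sequence m n ys)
      then have "ys = xs \<or> ys = rev xs"
        using label_sequence_unique[OF pair xs(1) _ q] by blast
      then show ?thesis
        using sequence by (auto simp: counts sequence_type_def sequence_class_rev)
    qed (use xs(2) counts in simp_all)
  next
    assume "T = sequence_type xs"
    then show "ordered_pair_type P1 C1 P2 C2 T"
      unfolding sequence_type_def using xs counts by (simp add: ordered_pair_type.sequence)
  qed
qed

lemma has_order_type_commute:
  "has_order_type P1 C1 P2 C2 T \<longleftrightarrow> has_order_type P2 C2 P1 C1 T"
  by (auto simp: has_order_type_def)

lemma circle_pair_commute: "circle_pair P1 C1 P2 C2 \<longleftrightarrow> circle_pair P2 C2 P1 C1"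
  by (auto simp: circle_pair_def)

text \<open>If the two numbers of points differ, only one order of the circles is admissible. If they agree, both
  are, and exchanging the circles exchanges the labels, which does not change the class.\<close>

lemma has_order_type_sequence_iff:
  assumes pair: "circle_pair P1 C1 P2 C2"
    and xs: "label_sequence P1 C1 P2 C2 xs" "on_first xs > 0" "on_second xs \<le> on_first xs"
  shows "has_order_type P1 C1 P2 C2 T \<longleftrightarrow> T = sequence_type xs"
proof (cases "on_second xs = on_first xs")
  case True
  have pair': "circle_pair P2 C2 P1 C1"
    using pair circle_pair_commute by blast
  have "sequence_type (map swap_label xs) = sequence_type xs"
    using True by (simp add: sequence_type_def sequence_class_swap)
  then show ?thesis
    using ordered_pair_type_sequence_iff[OF assms]
      ordered_pair_type_sequence_iff[OF pair' label_sequence_swap[OF pair xs(1)]] xs True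
    by (simp add: has_order_type_def)
next
  case False
  have planes: "is_plane P1" "is_plane P2" and circles: "circle_in P1 C1" "circle_in P2 C2"
    using pair by (auto simp: circle_pair_def)
  have counts: "num_real C1 P2 = on_first xs" "num_real C2 P1 = on_second xs"
    using num_real_eq_card[OF planes(1) circles(1) planes(2)] num_real_eq_card[OF planes(2) circles(2) planes(1)]
      label_sequence_counts[OF pair xs(1)] by simp_all
  have "\<not> ordered_pair_type P2 C2 P1 C1 T"
  proof
    assume "ordered_pair_type P2 C2 P1 C1 T"
    then show False
      using False xs counts by cases simp_all
  qed
  then show ?thesis
    using ordered_pair_type_sequence_iff[OF assms] by (simp add: has_order_type_def)
qed

lemma has_order_type_no_real_points:
  assumes pair: "circle_pair P1 C1 P2 C2" and empty: "C1 \<inter> P2 = {}" "C2 \<inter> P1 = {}"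
  shows "has_order_type P1 C1 P2 C2 T \<longleftrightarrow> T = (if pcl C1 \<inter> pcl C2 = {} then Disjoint else Conjugate)"
proof -
  have planes: "is_plane P1" "is_plane P2" and circles: "circle_in P1 C1" "circle_in P2 C2"
    using pair by (auto simp: circle_pair_def)
  have zero: "num_real C1 P2 = 0" "num_real C2 P1 = 0"
    using num_real_eq_card[OF planes(1) circles(1) planes(2)] num_real_eq_card[OF planes(2) circles(2) planes(1)]
      empty by simp_all
  show ?thesis
    using disjoint_or_conjugate[OF assms] zero
    unfolding has_order_type_def ordered_pair_type.simps
    by (simp add: Int_commute) (auto simp: Int_commute)
qed

text \<open>This gives uniqueness of the order type and, at the same time, restricts the possible types.\<close>

lemma order_type_cases:
  assumes "circle_pair P1 C1 P2 C2"
  obtains (none) T where "T \<in> {Disjoint, Conjugate}" "\<And>T'. has_order_type P1 C1 P2 C2 T' \<longleftrightarrow> T' = T"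
  | (sequence) xs where "on_second xs \<le> on_first xs" "0 < on_first xs" "on_first xs \<le> 2"
      "\<And>T'. has_order_type P1 C1 P2 C2 T' \<longleftrightarrow> T' = sequence_type xs"
proof -
  have ordered: "\<exists>xs. on_second xs \<le> on_first xs \<and> 0 < on_first xs \<and> on_first xs \<le> 2 \<and>
      (\<forall>T'. has_order_type P1 C1 P2 C2 T' \<longleftrightarrow> T' = sequence_type xs)"
    if pair: "circle_pair P1 C1 P2 C2" and le: "card (C2 \<inter> P1) \<le> card (C1 \<inter> P2)" "C1 \<inter> P2 \<noteq> {}"
    for P1 C1 P2 C2
  proof -
    have planes: "is_plane P1" "is_plane P2" "P1 \<noteq> P2" and circles: "circle_in P1 C1" "circle_in P2 C2"
      using pair by (auto simp: circle_pair_def)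
    have "finite (C1 \<inter> P2)" "card (C1 \<inter> P2) \<le> 2"
      using circle_meets_plane_finite[OF planes circles(1)] by blast+
    moreover obtain q where "q \<in> P1 \<inter> P2"
      using le(2) circles(1) by (auto elim: circle_inE)
    then obtain xs where xs: "label_sequence P1 C1 P2 C2 xs"
      using label_sequence_exists[OF pair] by blast
    ultimately show ?thesis
      using label_sequence_counts[OF pair xs] has_order_type_sequence_iff[OF pair xs] le
      by (intro exI[of _ xs]) (simp add: card_gt_0_iff)
  qed
  have planes: "is_plane P1" "is_plane P2" "P1 \<noteq> P2" and circles: "circle_in P1 C1" "circle_in P2 C2"
    using assms by (auto simp: circle_pair_def)
  have fin: "finite (C1 \<inter> P2)" "finite (C2 \<inter> P1)"
    using circle_meets_plane_finite(1)[OF planes circles(1)]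
      circle_meets_plane_finite(1)[OF planes(2,1) planes(3)[symmetric] circles(2)] by blast+
  have pair': "circle_pair P2 C2 P1 C1"
    using assms circle_pair_commute by blast
  consider "C1 \<inter> P2 = {}" "C2 \<inter> P1 = {}" | "card (C2 \<inter> P1) \<le> card (C1 \<inter> P2)" "C1 \<inter> P2 \<noteq> {}"
    | "card (C1 \<inter> P2) \<le> card (C2 \<inter> P1)" "C2 \<inter> P1 \<noteq> {}"
    using fin by (metis card_0_eq le_cases le_zero_eq)
  then show thesis
  proof cases
    case 1
    show thesis
      by (rule none[OF _ has_order_type_no_real_points[OF assms 1]]) simp
  next
    case 2
    then show thesis
      using ordered[OF assms 2] sequence by blast
  next
    case 3
    then show thesis
      using ordered[OF pair' 3] sequence has_order_type_commute[of P1 C1 P2 C2] by blast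
  qed
qed

text \<open>According to the number of prescribed points, the circle misses the line, touches it or has the
  segment between the two points as a diameter.\<close>

lemma circle_through_points_on_line:
  fixes e w :: "'a::real_inner"
  assumes "norm e = 1" "norm w = 1" "e \<bullet> w = 0" and "finite T" "card T \<le> 2"
  obtains m h r where "r > 0" "\<And>t. t *\<^sub>R e \<in> sphere (m *\<^sub>R e + h *\<^sub>R w) r \<longleftrightarrow> t \<in> T"
proof -
  have on: "t *\<^sub>R e \<in> sphere (m *\<^sub>R e + h *\<^sub>R w) r \<longleftrightarrow> (m - t)\<^sup>2 + h\<^sup>2 = r\<^sup>2" if "r > 0" for t m h r
  proof -
    have "m *\<^sub>R e + h *\<^sub>R w - t *\<^sub>R e = (m - t) *\<^sub>R e + h *\<^sub>R w"
      by (simp add: algebra_simps)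
    then have "(dist (m *\<^sub>R e + h *\<^sub>R w) (t *\<^sub>R e))\<^sup>2 = ((m - t) *\<^sub>R e + h *\<^sub>R w) \<bullet> ((m - t) *\<^sub>R e + h *\<^sub>R w)"
      by (simp only: dist_norm power2_norm_eq_inner)
    also have "\<dots> = (m - t)\<^sup>2 + h\<^sup>2"
    proof -
      have "(k *\<^sub>R e + h *\<^sub>R w) \<bullet> (k *\<^sub>R e + h *\<^sub>R w) = k\<^sup>2 + h\<^sup>2" for k
        using assms(1-3)
        by (simp add: inner_add_left inner_add_right inner_commute[of w e] norm_eq_1 power2_eq_square)
      then show ?thesis .
    qed
    finally show ?thesis
      using that by (metis less_eq_real_def mem_sphere power2_eq_iff_nonneg zero_le_dist)
  qed
  consider "T = {}" | a where "T = {a}" | a b where "a \<noteq> b" "T = {a, b}"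
  proof -
    have "card T = 0 \<or> card T = 1 \<or> card T = 2"
      using assms(5) by linarith
    then show thesis
      using that assms(4) by (metis card_0_eq card_1_singletonE card_2_iff)
  qed
  then show thesis
  proof cases
    case 1
    have "(0 - t)\<^sup>2 + 2\<^sup>2 \<noteq> (1 :: real)\<^sup>2" for t
    proof -
      have "0 < 3 + t\<^sup>2"
        by (simp add: add_pos_nonneg)
      then show ?thesis by simp
    qed
    then show thesis
      using on[of 1 _ 0 2] 1 by (intro that[of 1 0 2]) auto
  next
    case 2
    then show thesis
      using on[of 1 _ a 1] by (intro that[of 1 a 1]) auto
  next
    case 3
    define m where "m = (a + b) / 2"
    define r where "r = \<bar>a - b\<bar> / 2"
    have "(m - t)\<^sup>2 + 0\<^sup>2 = r\<^sup>2 \<longleftrightarrow> t \<in> T" for t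
    proof -
      have "(m - t)\<^sup>2 - r\<^sup>2 = (t - a) * (t - b)"
        by (simp add: m_def r_def power2_eq_square field_simps)
      then have "(m - t)\<^sup>2 = r\<^sup>2 \<longleftrightarrow> (t - a) * (t - b) = 0"
        by (metis right_minus_eq)
      then show ?thesis
        using 3 by simp
    qed
    moreover have "r > 0"
      using 3 by (simp add: r_def)
    ultimately show thesis
      using on[of r _ m 0] by (intro that[of r m 0]) auto
  qed
qed

section \<open>Realisation of the order types\<close>

lemma coordinate_plane:
  "is_plane {x :: real^3. x $ i = b}"
  unfolding is_plane_iff
  by (rule exI[of _ "axis i 1"], rule exI[of _ b]) (simp add: inner_axis' axis_eq_0_iff)

text \<open>In two coordinate planes that meet in a coordinate axis, the circles can be chosen independently of
  each other. Put the \<open>i\<close>-th label at the point \<open>i\<close> of the axis and let each circle meet the axis exactly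
  in the points at which a label asks for it.\<close>

lemma label_sequence_realised:
  assumes "on_first xs \<le> 2" "on_second xs \<le> 2"
  obtains P1 C1 P2 C2 where "circle_pair P1 C1 P2 C2" "label_sequence P1 C1 P2 C2 xs"
proof -
  define e w1 w2 :: "real^3" where "e = axis 1 1" and "w1 = axis 2 1" and "w2 = axis 3 1"
  have ew: "norm e = 1" "norm w1 = 1" "norm w2 = 1" "e \<bullet> w1 = 0" "e \<bullet> w2 = 0"
    by (simp_all add: e_def w1_def w2_def inner_axis_axis)
  define P1 P2 :: "(real^3) set" where "P1 = {x. x $ 3 = 0}" and "P2 = {x. x $ 2 = 0}"
  have line: "P1 \<inter> P2 = range (\<lambda>t. t *\<^sub>R e)"
  proof
    show "P1 \<inter> P2 \<subseteq> range (\<lambda>t. t *\<^sub>R e)"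
    proof
      fix x assume "x \<in> P1 \<inter> P2"
      then have "x = x $ 1 *\<^sub>R e"
        by (simp add: P1_def P2_def e_def vec_eq_iff forall_3 axis_def)
      then show "x \<in> range (\<lambda>t. t *\<^sub>R e)" by blast
    qed
  qed (auto simp: P1_def P2_def e_def axis_def)
  define T1 T2 where "T1 = real ` {i. i < length xs \<and> xs ! i \<noteq> L2}"
    and "T2 = real ` {i. i < length xs \<and> xs ! i \<noteq> L1}"
  have T: "finite T1" "card T1 \<le> 2" "finite T2" "card T2 \<le> 2"
    using assms
    by (simp_all add: T1_def T2_def card_image inj_on_def on_first_def on_second_def length_filter_conv_card)
  obtain m1 h1 r1 where C1: "r1 > 0" "\<And>t. t *\<^sub>R e \<in> sphere (m1 *\<^sub>R e + h1 *\<^sub>R w1) r1 \<longleftrightarrow> t \<in> T1"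
    using circle_through_points_on_line[OF ew(1,2,4) T(1,2)] by metis
  obtain m2 h2 r2 where C2: "r2 > 0" "\<And>t. t *\<^sub>R e \<in> sphere (m2 *\<^sub>R e + h2 *\<^sub>R w2) r2 \<longleftrightarrow> t \<in> T2"
    using circle_through_points_on_line[OF ew(1,3,5) T(3,4)] by metis
  define C1 C2 where "C1 = P1 \<inter> sphere (m1 *\<^sub>R e + h1 *\<^sub>R w1) r1"
    and "C2 = P2 \<inter> sphere (m2 *\<^sub>R e + h2 *\<^sub>R w2) r2"
  have "m1 *\<^sub>R e + h1 *\<^sub>R w1 \<in> P1" "m2 *\<^sub>R e + h2 *\<^sub>R w2 \<in> P2"
    by (simp_all add: P1_def P2_def e_def w1_def w2_def axis_def)
  then have "circle_in P1 C1" "circle_in P2 C2"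
    using C1(1) C2(1) unfolding circle_in_def C1_def C2_def by blast+
  moreover have "w1 \<in> P1" "w1 \<notin> P2"
    by (simp_all add: P1_def P2_def w1_def axis_def)
  then have "P1 \<noteq> P2" by blast
  ultimately have pair: "circle_pair P1 C1 P2 C2"
    by (simp add: circle_pair_def P1_def P2_def coordinate_plane)
  have on_line: "t *\<^sub>R e \<in> P1" "t *\<^sub>R e \<in> P2" for t
    using line by blast+
  have mem: "t *\<^sub>R e \<in> C1 \<longleftrightarrow> t \<in> T1" "t *\<^sub>R e \<in> C2 \<longleftrightarrow> t \<in> T2" for t
    unfolding C1_def C2_def using C1(2) C2(2) on_line by blast+
  have mem_idx: "real i *\<^sub>R e \<in> C1 \<longleftrightarrow> xs ! i \<noteq> L2" "real i *\<^sub>R e \<in> C2 \<longleftrightarrow> xs ! i \<noteq> L1" if "i < length xs" for i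
    using that by (auto simp: mem T1_def T2_def)
  define ps where "ps = map (\<lambda>i. real i *\<^sub>R e) [0..<length xs]"
  have "C1 \<inter> P2 = (\<lambda>t. t *\<^sub>R e) ` T1" "C2 \<inter> P1 = (\<lambda>t. t *\<^sub>R e) ` T2"
  proof -
    have "C1 \<inter> P2 = C1 \<inter> range (\<lambda>t. t *\<^sub>R e)" "C2 \<inter> P1 = C2 \<inter> range (\<lambda>t. t *\<^sub>R e)"
      unfolding line[symmetric] C1_def C2_def by blast+
    then show "C1 \<inter> P2 = (\<lambda>t. t *\<^sub>R e) ` T1" "C2 \<inter> P1 = (\<lambda>t. t *\<^sub>R e) ` T2"
      using mem by auto
  qed
  moreover have "T1 \<union> T2 = real ` {..<length xs}"
    by (auto simp: T1_def T2_def)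
  ultimately have "(C1 \<inter> P2) \<union> (C2 \<inter> P1) = (\<lambda>t. t *\<^sub>R e) ` real ` {..<length xs}"
    by (simp only: image_Un[symmetric])
  then have "set ps = (C1 \<inter> P2) \<union> (C2 \<inter> P1)"
    by (simp add: ps_def image_image atLeast0LessThan)
  moreover have "xs = map (point_label C1 C2) ps"
  proof (rule nth_equalityI)
    show "xs ! i = map (point_label C1 C2) ps ! i" if "i < length xs" for i
      using that mem_idx[OF that] by (cases "xs ! i") (simp_all add: ps_def point_label_def)
  qed (simp add: ps_def)
  moreover have "sorted_wrt (\<lambda>x y. x \<bullet> e < y \<bullet> e) ps"
    using ew(1) by (simp add: ps_def sorted_wrt_map norm_eq_1 sorted_wrt_upt)
  moreover have "(\<forall>x\<in>P1. x + e \<in> P1) \<and> (\<forall>x\<in>P2. x + e \<in> P2)"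
    by (simp add: P1_def P2_def e_def axis_def)
  moreover have "e \<noteq> 0"
    using ew(1) by auto
  ultimately have "label_sequence P1 C1 P2 C2 xs"
    unfolding label_sequence_real_iff[OF pair] by blast
  with pair that show thesis by blast
qed

text \<open>On the common line, with coordinate \<open>t\<close>, the two circles have the equations \<open>t\<^sup>2 = - 3\<close> and
  \<open>t\<^sup>2 = - 8\<close>.\<close>

lemma disjoint_realised:
  obtains P1 C1 P2 C2 where "circle_pair P1 C1 P2 C2" "has_order_type P1 C1 P2 C2 Disjoint"
proof -
  define P1 P2 :: "(real^3) set" where "P1 = {x. x $ 3 = 0}" and "P2 = {x. x $ 2 = 0}"
  define c1 c2 :: "real^3" where "c1 = axis 2 2" and "c2 = axis 3 3"
  define C1 C2 where "C1 = P1 \<inter> sphere c1 1" and "C2 = P2 \<inter> sphere c2 1"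
  have "c1 \<in> P1" "c1 \<notin> P2" "c2 \<in> P2"
    by (simp_all add: P1_def P2_def c1_def c2_def axis_def)
  moreover from this have "circle_in P1 C1" "circle_in P2 C2"
    unfolding circle_in_def C1_def C2_def using zero_less_one by blast+
  ultimately have pair: "circle_pair P1 C1 P2 C2"
    by (auto simp: circle_pair_def P1_def P2_def coordinate_plane)
  have sub: "C1 \<subseteq> {x. axis 3 1 \<bullet> x = 0}" "C2 \<subseteq> {x. axis 2 1 \<bullet> x = 0}" "C1 \<subseteq> sphere c1 1" "C2 \<subseteq> sphere c2 1"
    by (auto simp: C1_def C2_def P1_def P2_def inner_axis')
  have disjoint: "pcl C1 \<inter> pcl C2 = {}"
  proof (rule ccontr)
    assume "pcl C1 \<inter> pcl C2 \<noteq> {}"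
    then obtain p where p: "p \<in> pcl C1" "p \<in> pcl C2" by blast
    obtain z where z: "z \<noteq> 0" "p = abs_cp3 z"
      by (rule cp3_cases)
    have "z $ 3 = 0" "z $ 2 = 0"
      using plane_form_pcl[OF z(1) _ sub(1)] plane_form_pcl[OF z(1) _ sub(2)] p z
      by (simp_all add: plane_form_def axis_def)
    moreover from this have "(z $ 1)\<^sup>2 + 3 * (z $ 4)\<^sup>2 = 0" "(z $ 1)\<^sup>2 + 8 * (z $ 4)\<^sup>2 = 0"
      using sphere_form_pcl[OF z(1) _ sub(3)] sphere_form_pcl[OF z(1) _ sub(4)] p z
      by (simp_all add: sphere_form_def c1_def c2_def axis_def inner_vec_def sum_3)
    then have "5 * (z $ 4)\<^sup>2 = 0" "(z $ 1)\<^sup>2 = - 3 * (z $ 4)\<^sup>2"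
      by algebra+
    ultimately show False
      using z(1) by (simp add: vec_eq_iff forall_4)
  qed
  have empty: "C1 \<inter> P2 = {}" "C2 \<inter> P1 = {}"
  proof -
    have no_real: False if "x \<in> P1 \<inter> P2" "x \<in> C1 \<or> x \<in> C2" for x
    proof -
      have "x $ 2 = 0" "x $ 3 = 0"
        using that(1) by (simp_all add: P1_def P2_def)
      then have "sphere_form c1 1 (lift x) = of_real ((x $ 1)\<^sup>2 + 3)"
        "sphere_form c2 1 (lift x) = of_real ((x $ 1)\<^sup>2 + 8)"
        by (simp_all add: sphere_form_def c1_def c2_def axis_def inner_vec_def sum_3)
      moreover have "(x $ 1)\<^sup>2 + 3 \<noteq> 0" "(x $ 1)\<^sup>2 + 8 \<noteq> 0"
        using zero_le_power2[of "x $ 1"] by linarith+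
      ultimately have "sphere_form c1 1 (lift x) \<noteq> 0" "sphere_form c2 1 (lift x) \<noteq> 0"
        by (simp_all only: of_real_eq_0_iff not_False_eq_True)
      then show False
        using that(2) unfolding sphere_form_lift_eq_0_iff[OF zero_less_one] C1_def C2_def by blast
    qed
    moreover have "C1 \<subseteq> P1" "C2 \<subseteq> P2"
      by (auto simp: C1_def C2_def)
    ultimately show "C1 \<inter> P2 = {}" "C2 \<inter> P1 = {}"
      by blast+
  qed
  show thesis
    using has_order_type_no_real_points[OF pair empty] disjoint by (intro that[OF pair]) simp
qed

text \<open>Circles in parallel planes pass through the same circular points at infinity.\<close>

lemma conjugate_realised:
  obtains P1 C1 P2 C2 where "circle_pair P1 C1 P2 C2" "has_order_type P1 C1 P2 C2 Conjugate"
proof -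
  define P :: "real \<Rightarrow> (real^3) set" where "P b = {x. axis 3 1 \<bullet> x = b}" for b
  define c :: "real \<Rightarrow> real^3" where "c b = axis 3 b" for b
  define C where "C b = P b \<inter> sphere (c b) 1" for b
  have plane: "is_plane (P b)" for b
    using coordinate_plane[of 3 b] by (simp add: P_def inner_axis')
  have "c b \<in> P b" for b
    by (simp add: P_def c_def inner_axis_axis)
  then have circle: "circle_in (P b) (C b)" for b
    unfolding circle_in_def C_def using zero_less_one by blast
  have PP: "P 0 \<inter> P 1 = {}"
    by (auto simp: P_def)
  moreover have "c 0 \<in> P 0" by fact
  ultimately have pair: "circle_pair (P 0) (C 0) (P 1) (C 1)"
    using plane circle by (auto simp: circle_pair_def)
  define z where "z b = lift (c b + 1 *\<^sub>R axis 1 1) + \<i> *s (lift ((2 * 1) *\<^sub>R axis 2 1) - lift 0)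
    + \<i>\<^sup>2 *s lift (c b - 1 *\<^sub>R axis 1 1)" for b
  have "abs_cp3 (z b) \<in> pcl (C b)" for b
    unfolding z_def C_def P_def
    by (rule circle_curve_in_pcl(2)) (simp_all add: c_def inner_axis_axis)
  moreover have "z 0 = z 1"
    by (simp add: z_def c_def vec_eq_iff forall_4 axis_def)
  ultimately have "abs_cp3 (z 0) \<in> pcl (C 0) \<inter> pcl (C 1)"
    by (metis IntI)
  moreover have "C 0 \<inter> P 1 = {}" "C 1 \<inter> P 0 = {}"
    using PP by (auto simp: C_def)
  ultimately show thesis
    using has_order_type_no_real_points[OF pair] pair by (intro that[OF pair]) auto
qed

section \<open>Enumeration of the classes of label sequences\<close>

text \<open>The rows list the intersection types \<open>[m, 0]\<close>, \<open>[1, 1]\<close>, \<open>[2, 1]\<close> and \<open>[2, 2]\<close>.\<close>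

definition representatives :: "label list list" where
  "representatives = [[L1], [L1, L1],
     [L1, L2], [S],
     [L1, L1, L2], [L1, L2, L1], [L1, S],
     [L1, L1, L2, L2], [L1, L2, L1, L2], [L1, L2, L2, L1], [L1, S, L2], [L1, L2, S], [S, S]]"

text \<open>Each label belongs to at least one circle; this bounds the sequences to be enumerated.\<close>

lemma length_le_counts: "length xs \<le> on_first xs + on_second xs"
  unfolding on_first_def on_second_def by (induction xs) auto

text \<open>Admissible sequences have at most four labels, so the enumeration of the classes is a finite
  computation.\<close>

lemma representatives_complete:
  "\<forall>xs\<in>set (concat (map (\<lambda>n. List.n_lists n [L1, L2, S]) [0..<5])).
     on_second xs \<le> on_first xs \<and> 0 < on_first xs \<and> on_first xs \<le> 2 \<longrightarrow>
     (\<exists>ys\<in>set representatives. ys \<in> sequence_class (on_first xs) (on_second xs) xs)"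
  by code_simp

lemma representatives_inequivalent:
  "\<forall>xs\<in>set representatives. \<forall>ys\<in>set representatives.
     ys \<in> sequence_class (on_first xs) (on_second xs) xs \<longrightarrow> ys = xs"
  by code_simp

lemma representatives_admissible:
  "distinct representatives \<and> length representatives = 13 \<and>
    (\<forall>xs\<in>set representatives. on_second xs \<le> on_first xs \<and> 0 < on_first xs \<and> on_first xs \<le> 2)"
  by code_simp

lemma sequence_types_eq:
  "sequence_type ` {xs. on_second xs \<le> on_first xs \<and> 0 < on_first xs \<and> on_first xs \<le> 2}
    = sequence_type ` set representatives"
proof
  show "sequence_type ` {xs. on_second xs \<le> on_first xs \<and> 0 < on_first xs \<and> on_first xs \<le> 2}
      \<subseteq> sequence_type ` set representatives"
  proof
    fix T assume "T \<in> sequence_type ` {xs. on_second xs \<le> on_first xs \<and> 0 < on_first xs \<and> on_first xs \<le> 2}"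
    then obtain xs where xs: "T = sequence_type xs"
      "on_second xs \<le> on_first xs" "0 < on_first xs" "on_first xs \<le> 2" by blast
    have "set xs \<subseteq> {L1, L2, S}"
      using label.exhaust by blast
    moreover have "length xs < 5"
      using length_le_counts[of xs] xs by linarith
    ultimately have "xs \<in> set (concat (map (\<lambda>n. List.n_lists n [L1, L2, S]) [0..<5]))"
      by (simp add: set_n_lists)
    then obtain ys where "ys \<in> set representatives" "ys \<in> sequence_class (on_first xs) (on_second xs) xs"
      using representatives_complete xs(2-4) by blast
    then show "T \<in> sequence_type ` set representatives"
      using xs(1) sequence_type_eq_iff by blast
  qed
  show "sequence_type ` set representatives
      \<subseteq> sequence_type ` {xs. on_second xs \<le> on_first xs \<and> 0 < on_first xs \<and> on_first xs \<le> 2}"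
    using representatives_admissible by blast
qed

lemma card_sequence_types: "card (sequence_type ` set representatives) = 13"
proof -
  have "inj_on sequence_type (set representatives)"
    using representatives_inequivalent unfolding inj_on_def sequence_type_eq_iff by blast
  then show ?thesis
    using representatives_admissible by (simp add: card_image distinct_card)
qed

theorem lemma4p1:
  shows "(\<forall>P1 C1 P2 C2. circle_pair P1 C1 P2 C2 \<longrightarrow> (\<exists>!T. has_order_type P1 C1 P2 C2 T)) \<and>
    card {T. \<exists>P1 C1 P2 C2. circle_pair P1 C1 P2 C2 \<and> has_order_type P1 C1 P2 C2 T} = 15"
proof (intro conjI allI impI)
  show "\<exists>!T. has_order_type P1 C1 P2 C2 T" if "circle_pair P1 C1 P2 C2" for P1 C1 P2 C2
    using that by (cases rule: order_type_cases) auto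
  let ?types = "{T. \<exists>P1 C1 P2 C2. circle_pair P1 C1 P2 C2 \<and> has_order_type P1 C1 P2 C2 T}"
  let ?sequences = "{xs. on_second xs \<le> on_first xs \<and> 0 < on_first xs \<and> on_first xs \<le> 2}"
  have "?types = {Disjoint, Conjugate} \<union> sequence_type ` ?sequences"
  proof
    show "?types \<subseteq> {Disjoint, Conjugate} \<union> sequence_type ` ?sequences"
    proof
      fix T assume "T \<in> ?types"
      then obtain P1 C1 P2 C2 where pair: "circle_pair P1 C1 P2 C2" and T: "has_order_type P1 C1 P2 C2 T"
        by blast
      from pair show "T \<in> {Disjoint, Conjugate} \<union> sequence_type ` ?sequences"
        by (cases rule: order_type_cases) (use T in auto)
    qed
    have "Disjoint \<in> ?types"
      by (rule disjoint_realised) blast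
    moreover have "Conjugate \<in> ?types"
      by (rule conjugate_realised) blast
    moreover have "sequence_type xs \<in> ?types" if "xs \<in> ?sequences" for xs
    proof -
      have "on_first xs \<le> 2" "on_second xs \<le> 2" using that by auto
      then obtain P1 C1 P2 C2 where "circle_pair P1 C1 P2 C2" "label_sequence P1 C1 P2 C2 xs"
        by (rule label_sequence_realised)
      then have "circle_pair P1 C1 P2 C2" "has_order_type P1 C1 P2 C2 (sequence_type xs)"
        using has_order_type_sequence_iff[of P1 C1 P2 C2 xs] that by auto
      then show ?thesis by blast
    qed
    ultimately show "{Disjoint, Conjugate} \<union> sequence_type ` ?sequences \<subseteq> ?types"
      by blast
  qed
  also have "\<dots> = {Disjoint, Conjugate} \<union> sequence_type ` set representatives"
    by (simp only: sequence_types_eq)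
  also have "card \<dots> = card {Disjoint, Conjugate} + card (sequence_type ` set representatives)"
    by (rule card_Un_disjoint) (auto simp: sequence_type_def)
  also have "\<dots> = 15"
    by (simp add: card_sequence_types)
  finally show "card ?types = 15" .
qed

end
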